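(* Let $(X,\mathcal R)$ be an association scheme of class $d$ that is both $P$-polynomial and $Q$-polynomial, the latter with respect to $E_0,E_1,\dots,E_d$. Write $E_1=\frac1{|X|}\sum_{j=0}^d\theta_j^*A_j$ and let $\tilde X\subset S^{\theta_0^*-1}$ be the image of $X$ under the embedding into the first eigenspace by $E_1$. If $\tilde X$ is a spherical $t$-design in $S^{\theta_0^*-1}$, then $t\le 8$.
   Context: A symmetric association scheme of class $d$: finite set $X$, partition $\{R_0,\dots,R_d\}$ of $X\times X$ with adjacency matrices $A_i$ satisfying $A_0=I$, $\sum A_i=J$, $A_i^T=A_i$, $A_iA_j\in\operatorname{span}\{A_k\}$; primitive idempotents $E_0=\frac1{|X|}J,E_1,\dots,E_d$; Krein parameters $q_{i,j}^k$ given by $E_i\circ E_j=\frac1{|X|}\sum_kq_{i,j}^kE_k$. $P$-polynomial means that (for a suitable ordering of the relations) $(X,R_1)$ is a distance-regular graph and $R_i$ is the distance-$i$ relation of this graph. $Q$-polynomial with respect to $E_0,\dots,E_d$ means $q_{1,i}^j=0$ for $|i-j|>1$ and $q_{1,i}^{i+1},q_{1,i+1}^{i}>0$. The embedding sends $x\in X$ to the unit vector $\sqrt{|X|/\theta_0^*}\,E_1e_x$ in the $\theta_0^*$-dimensional column space of $E_1$, identified with $\mathbb R^{\theta_0^*}$. A finite $Y\subset S^{n-1}$ is a spherical $t$-design if the average over $Y$ of every polynomial of degree $\le t$ equals its average over $S^{n-1}$.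
   Formalization: The formal theorem assumes θ₀* > 2, which excludes exactly K₂ and the ordinary polygons; without it the claim fails, since the regular m-gon with m ≥ 10 is an (m−1)-design in S¹ and K₂ gives all of S⁰. *)

theory Defs
  imports "HOL-Analysis.Analysis"
begin

text \<open>The point set \<open>X\<close> is the finite type \<open>'x\<close>. Families indexed by \<open>0, \<dots>, d\<close> are functions on
  \<open>nat\<close>; their values above \<open>d\<close> are never used.\<close>

definition adj_matrix :: "('x \<times> 'x) set \<Rightarrow> real^'x^'x" where
  "adj_matrix S = (\<chi> x y. if (x, y) \<in> S then 1 else 0)"

definition all_ones :: "real^'x^'x" where
  "all_ones = (\<chi> x y. 1)"

definition hadamard :: "real^'x^'x \<Rightarrow> real^'x^'x \<Rightarrow> real^'x^'x" where
  "hadamard A B = (\<chi> x y. A $ x $ y * B $ x $ y)"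

definition bose_mesner :: "nat \<Rightarrow> (nat \<Rightarrow> ('x::finite \<times> 'x) set) \<Rightarrow> (real^'x^'x) set" where
  "bose_mesner d R = span ((\<lambda>k. adj_matrix (R k)) ` {..d})"

definition symmetric_association_scheme ::
    "nat \<Rightarrow> (nat \<Rightarrow> ('x::finite \<times> 'x) set) \<Rightarrow> bool" where
  "symmetric_association_scheme d R \<longleftrightarrow>
     (\<forall>i\<le>d. R i \<noteq> {}) \<and>
     disjoint_family_on R {..d} \<and>
     (\<Union>i\<le>d. R i) = UNIV \<and>
     R 0 = Id \<and>
     (\<forall>i\<le>d. sym (R i)) \<and>
     (\<forall>i\<le>d. \<forall>j\<le>d. adj_matrix (R i) ** adj_matrix (R j) \<in> bose_mesner d R)"

definition primitive_idempotent_in :: "(real^'x^'x) set \<Rightarrow> real^'x^'x \<Rightarrow> bool" where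
  "primitive_idempotent_in \<A> E \<longleftrightarrow>
     E \<in> \<A> \<and> E \<noteq> 0 \<and> E ** E = E \<and>
     \<not> (\<exists>F G. F \<in> \<A> \<and> G \<in> \<A> \<and> F \<noteq> 0 \<and> G \<noteq> 0 \<and> F ** F = F \<and> G ** G = G \<and>
             F ** G = 0 \<and> G ** F = 0 \<and> E = F + G)"

definition primitive_idempotents ::
    "nat \<Rightarrow> (nat \<Rightarrow> ('x::finite \<times> 'x) set) \<Rightarrow> (nat \<Rightarrow> real^'x^'x) \<Rightarrow> bool" where
  "primitive_idempotents d R E \<longleftrightarrow>
     bij_betw E {..d} {F. primitive_idempotent_in (bose_mesner d R) F} \<and>
     E 0 = (1 / real CARD('x)) *\<^sub>R all_ones"

text \<open>\<open>q i j k\<close> stands for \<open>q\<^bsub>i,j\<^esub>\<^sup>k\<close>.\<close>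

definition krein_parameters ::
    "nat \<Rightarrow> (nat \<Rightarrow> real^'x^'x) \<Rightarrow> (nat \<Rightarrow> nat \<Rightarrow> nat \<Rightarrow> real) \<Rightarrow> bool" where
  "krein_parameters d E q \<longleftrightarrow>
     (\<forall>i\<le>d. \<forall>j\<le>d.
        hadamard (E i) (E j) = (1 / real CARD('x)) *\<^sub>R (\<Sum>k\<le>d. q i j k *\<^sub>R E k))"

definition Q_polynomial :: "nat \<Rightarrow> (nat \<Rightarrow> nat \<Rightarrow> nat \<Rightarrow> real) \<Rightarrow> bool" where
  "Q_polynomial d q \<longleftrightarrow>
     (\<forall>i\<le>d. \<forall>j\<le>d. \<bar>int i - int j\<bar> > 1 \<longrightarrow> q 1 i j = 0) \<and>
     (\<forall>i<d. q 1 i (i + 1) > 0 \<and> q 1 (i + 1) i > 0)"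

text \<open>For a connected graph with edge relation \<open>\<Gamma>\<close>, the length of a shortest walk from \<open>x\<close> to \<open>y\<close>.\<close>

definition graph_dist :: "('x \<times> 'x) set \<Rightarrow> 'x \<Rightarrow> 'x \<Rightarrow> nat" where
  "graph_dist \<Gamma> x y = (LEAST n. (x, y) \<in> \<Gamma> ^^ n)"

definition distance_regular_graph :: "('x \<times> 'x) set \<Rightarrow> bool" where
  "distance_regular_graph \<Gamma> \<longleftrightarrow>
     sym \<Gamma> \<and> irrefl \<Gamma> \<and> \<Gamma>\<^sup>* = UNIV \<and>
     (\<exists>b c :: nat \<Rightarrow> nat. \<forall>x y.
        card {z. (y, z) \<in> \<Gamma> \<and> graph_dist \<Gamma> x z = graph_dist \<Gamma> x y + 1} = b (graph_dist \<Gamma> x y) \<and>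
        card {z. (y, z) \<in> \<Gamma> \<and> graph_dist \<Gamma> x z + 1 = graph_dist \<Gamma> x y} = c (graph_dist \<Gamma> x y))"

definition P_polynomial :: "nat \<Rightarrow> (nat \<Rightarrow> ('x \<times> 'x) set) \<Rightarrow> bool" where
  "P_polynomial d R \<longleftrightarrow>
     (\<exists>\<sigma>. bij_betw \<sigma> {..d} {..d} \<and>
        distance_regular_graph (R (\<sigma> 1)) \<and>
        (\<forall>i\<le>d. R (\<sigma> i) = {(x, y). graph_dist (R (\<sigma> 1)) x y = i}))"

text \<open>The normalized surface measure on the unit sphere, as the image of the uniform distribution
  on the unit ball under the radial projection \<open>sgn x = x / \<parallel>x\<parallel>\<close>.\<close>

definition sphere_measure :: "(real^'n) measure" where
  "sphere_measure = distr (uniform_measure lborel (ball 0 1)) borel sgn"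

text \<open>Polynomial functions of total degree at most \<open>t\<close>: each exponent vector \<open>a\<close> contributes the
  monomial \<open>\<Prod>\<^sub>i x\<^sub>i\<^bsup>a i\<^esup>\<close>.\<close>

definition polynomial_of_degree_le :: "nat \<Rightarrow> (real^'n \<Rightarrow> real) \<Rightarrow> bool" where
  "polynomial_of_degree_le t f \<longleftrightarrow>
     (\<exists>c :: ('n \<Rightarrow> nat) \<Rightarrow> real.
        f = (\<lambda>x. \<Sum>a | (\<Sum>i\<in>UNIV. a i) \<le> t. c a * (\<Prod>i\<in>UNIV. (x $ i) ^ a i)))"

definition spherical_design :: "nat \<Rightarrow> (real^'n) set \<Rightarrow> bool" where
  "spherical_design t Y \<longleftrightarrow>
     finite Y \<and> Y \<noteq> {} \<and> Y \<subseteq> sphere 0 1 \<and>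
     (\<forall>f. polynomial_of_degree_le t f \<longrightarrow>
        (\<Sum>y\<in>Y. f y) / real (card Y) = (\<integral>x. f x \<partial>sphere_measure))"

text \<open>An isometric identification \<open>\<phi>\<close> of the column space of \<open>M\<close> with \<open>\<real>\<^sup>n\<close>, \<open>n = CARD('n)\<close>. It is
  given as a linear map on the ambient space, of which only the restriction matters; such a map
  exists if and only if \<open>n\<close> is the rank of \<open>M\<close>.\<close>

definition column_space_identification :: "real^'x^'x \<Rightarrow> (real^'x \<Rightarrow> real^'n) \<Rightarrow> bool" where
  "column_space_identification M \<phi> \<longleftrightarrow>
     linear \<phi> \<and> (\<forall>v \<in> span (columns M). norm (\<phi> v) = norm v) \<and> \<phi> ` span (columns M) = UNIV"

definition spherical_embedding ::
    "(real^'x \<Rightarrow> real^'n) \<Rightarrow> real^'x^'x \<Rightarrow> real \<Rightarrow> 'x::finite \<Rightarrow> real^'n" where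
  "spherical_embedding \<phi> M m x = \<phi> (sqrt (real CARD('x) / m) *\<^sub>R (M *v axis x 1))"

end

theory Submission
  imports Defs "HOL-Computational_Algebra.Polynomial"
begin

text \<open>Let \<open>G\<close> be the Gram matrix of the embedded points and let \<open>A\<close> be the adjacency matrix of the
  distance-regular graph, with eigenvalue \<open>\<theta>\<^sub>i\<close> on the column space of \<open>E\<^sub>i\<close>.

  If the points form a spherical 7-design, the distribution of the entries in a row of \<open>G\<close> has the
  moments of one coordinate of the sphere up to degree 7. Since \<open>E\<^sub>i\<close> is an entrywise polynomial of
  degree \<open>i\<close> in \<open>G\<close>, orthogonality forces \<open>E\<^sub>i\<close> to be proportional to the Gegenbauer polynomial
  \<open>g\<^sub>i\<close> of \<open>G\<close> for \<open>i \<le> 4\<close>; in particular \<open>d \<ge> 4\<close>, and \<open>\<theta>\<^sub>i = k g\<^sub>i(\<xi>)\<close>, where \<open>k\<close> is the valency and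
  \<open>\<xi>\<close> is the inner product of two adjacent points. By Terwilliger's recurrence for P- and
  Q-polynomial schemes, \<open>(\<theta>\<^sub>i - \<theta>\<^bsub>i+3\<^esub>) / (\<theta>\<^bsub>i+1\<^esub> - \<theta>\<^bsub>i+2\<^esub>)\<close> does not depend on \<open>i\<close>. For \<open>i = 0, 1\<close> the
  Gegenbauer polynomials violate this by a nonzero multiple of \<open>(\<xi> - 1)\<^sup>4 (\<xi> + 1)\<^sup>2 (n\<^sup>2 - 4)\<close>,
  so \<open>\<xi> = \<plusminus>1\<close>, which makes two of the \<open>\<theta>\<^sub>i\<close> equal. Hence even \<open>t \<le> 6\<close> holds.\<close>

section \<open>Moments of the uniform measure on the sphere\<close>

lemma nn_integral_lborel_translate:
  fixes f :: "'a::euclidean_space \<Rightarrow> ennreal"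
  assumes [measurable]: "f \<in> borel_measurable borel"
  shows "(\<integral>\<^sup>+x. f (x + a) \<partial>lborel) = (\<integral>\<^sup>+x. f x \<partial>lborel)"
proof -
  have "(\<integral>\<^sup>+x. f x \<partial>lborel) = (\<integral>\<^sup>+x. f x \<partial>distr lborel borel ((+) a))"
    by (simp add: lborel_distr_plus)
  also have "\<dots> = (\<integral>\<^sup>+x. f (x + a) \<partial>lborel)"
    by (subst nn_integral_distr) (auto simp: add.commute)
  finally show ?thesis ..
qed

lemma nn_integral_lborel_reflect:
  fixes f :: "'a::euclidean_space \<Rightarrow> ennreal"
  assumes [measurable]: "f \<in> borel_measurable borel"
  shows "(\<integral>\<^sup>+x. f (a - x) \<partial>lborel) = (\<integral>\<^sup>+x. f x \<partial>lborel)"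
proof -
  have "(\<integral>\<^sup>+x. f x \<partial>lborel) = (\<integral>\<^sup>+x. f x \<partial>density (distr lborel borel (\<lambda>x. a + (- 1) *\<^sub>R x)) (\<lambda>_. ennreal (\<bar>- 1\<bar> ^ DIM('a))))"
    using lborel_affine[of "- 1" a] by simp
  also have "\<dots> = (\<integral>\<^sup>+x. f (a - x) \<partial>lborel)"
    by (simp add: nn_integral_density nn_integral_distr)
  finally show ?thesis ..
qed

lemma orthogonal_transformation_borel_measurable:
  fixes T :: "'a::euclidean_space \<Rightarrow> 'a"
  assumes "orthogonal_transformation T"
  shows "T \<in> borel_measurable borel"
  using orthogonal_transformation_linear[OF assms]
  by (intro borel_measurable_continuous_onI linear_continuous_on)
    (simp add: linear_conv_bounded_linear)

lemma emeasure_unit_ball: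
  "emeasure lborel (ball (0::'a::euclidean_space) 1) \<noteq> 0"
  "emeasure lborel (ball (0::'a::euclidean_space) 1) \<noteq> \<infinity>"
  using emeasure_lborel_ball_finite[of "0::'a" 1] content_ball_pos[of 1 "0::'a"]
  by (auto simp: emeasure_eq_ennreal_measure)

text \<open>The uniqueness argument for Haar measure, applied to \<open>f \<circ> T\<close> and the rotation invariant
  indicator of the unit ball.\<close>

lemma nn_integral_lborel_orthogonal:
  fixes T :: "'a::euclidean_space \<Rightarrow> 'a" and f :: "'a \<Rightarrow> ennreal"
  assumes T: "orthogonal_transformation T" and [measurable]: "f \<in> borel_measurable borel"
  shows "(\<integral>\<^sup>+x. f (T x) \<partial>lborel) = (\<integral>\<^sup>+x. f x \<partial>lborel)"
proof -
  define B :: "'a \<Rightarrow> ennreal" where "B = indicator (ball 0 1)"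
  define b where "b = (\<integral>\<^sup>+x. B x \<partial>lborel)"
  have lin: "linear T" using T by (rule orthogonal_transformation_linear)
  note [measurable] = orthogonal_transformation_borel_measurable[OF T]
  have [measurable]: "B \<in> borel_measurable borel"
    unfolding B_def by (intro borel_measurable_indicator) auto
  have inv: "T (inv T y) = y" for y
    using T by (simp add: orthogonal_transformation_surj surj_f_inv_f)
  have add: "T (x + inv T y) = T x + y" for x y
    using lin by (simp add: linear_add inv)
  \<comment> \<open>In this form the integral over \<open>x\<close> can be reflected, which gives
    \<open>b\<close> for every \<open>y\<close>.\<close>
  have BT: "B (y - T x) = B (inv T y - x)" for x y
  proof -
    have "y - T x = T (inv T y - x)" using lin by (simp add: linear_diff inv)
    then show ?thesis
      using T by (simp add: B_def indicator_def orthogonal_transformation_norm)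
  qed
  have b: "b = emeasure lborel (ball (0::'a) 1)"
    by (simp add: b_def B_def)
  \<comment> \<open>This allows \<open>b\<close> to be cancelled at the end. The integral of
    \<open>f (T x)\<close> times \<open>b\<close> is now evaluated in both orders of
    integration.\<close>
  have "b \<noteq> 0" "b \<noteq> \<infinity>"
    unfolding b by (rule emeasure_unit_ball)+
  have "(\<integral>\<^sup>+x. f (T x) \<partial>lborel) * b = (\<integral>\<^sup>+y. (\<integral>\<^sup>+x. f (T x) \<partial>lborel) * B y \<partial>lborel)"
    unfolding b_def by (simp add: nn_integral_cmult)
  also have "\<dots> = (\<integral>\<^sup>+y. (\<integral>\<^sup>+x. f (T x + y) * B y \<partial>lborel) \<partial>lborel)"
  proof (rule nn_integral_cong)
    fix y
    have "(\<integral>\<^sup>+x. f (T x) \<partial>lborel) = (\<integral>\<^sup>+x. f (T x + y) \<partial>lborel)"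
      using nn_integral_lborel_translate[of "\<lambda>x. f (T x)" "inv T y"] by (simp add: add)
    then show "(\<integral>\<^sup>+x. f (T x) \<partial>lborel) * B y = (\<integral>\<^sup>+x. f (T x + y) * B y \<partial>lborel)"
      by (simp add: nn_integral_multc)
  qed
  also have "\<dots> = (\<integral>\<^sup>+x. (\<integral>\<^sup>+y. f (T x + y) * B y \<partial>lborel) \<partial>lborel)"
    by (rule lborel_pair.Fubini') measurable
  also have "\<dots> = (\<integral>\<^sup>+x. (\<integral>\<^sup>+y. f y * B (y - T x) \<partial>lborel) \<partial>lborel)"
  proof (rule nn_integral_cong)
    fix x
    show "(\<integral>\<^sup>+y. f (T x + y) * B y \<partial>lborel) = (\<integral>\<^sup>+y. f y * B (y - T x) \<partial>lborel)"
      using nn_integral_lborel_translate[of "\<lambda>y. f y * B (y - T x)" "T x"]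
      by (simp add: add.commute)
  qed
  also have "\<dots> = (\<integral>\<^sup>+y. (\<integral>\<^sup>+x. f y * B (y - T x) \<partial>lborel) \<partial>lborel)"
    by (rule lborel_pair.Fubini') measurable
  also have "\<dots> = (\<integral>\<^sup>+y. f y * b \<partial>lborel)"
    by (simp add: BT nn_integral_cmult nn_integral_lborel_reflect b_def)
  also have "\<dots> = (\<integral>\<^sup>+y. f y \<partial>lborel) * b"
    by (simp add: nn_integral_multc)
  finally show ?thesis
    using \<open>b \<noteq> 0\<close> \<open>b \<noteq> \<infinity>\<close> by (simp add: mult.commute[of _ b] ennreal_mult_cancel_left)
qed

lemma distr_lborel_orthogonal:
  fixes T :: "'a::euclidean_space \<Rightarrow> 'a"
  assumes T: "orthogonal_transformation T"
  shows "distr lborel borel T = lborel"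
proof (rule measure_eqI)
  note [measurable] = orthogonal_transformation_borel_measurable[OF T]
  fix A assume "A \<in> sets (distr lborel borel T)"
  then have [measurable]: "A \<in> sets borel" by simp
  have "emeasure (distr lborel borel T) A = (\<integral>\<^sup>+x. indicator A x \<partial>distr lborel borel T)"
    by simp
  also have "\<dots> = (\<integral>\<^sup>+x. indicator A (T x) \<partial>lborel)"
    by (subst nn_integral_distr) auto
  also have "\<dots> = emeasure lborel A"
    by (subst nn_integral_lborel_orthogonal[OF T]) auto
  finally show "emeasure (distr lborel borel T) A = emeasure lborel A" .
qed simp

section \<open>The sphere measure: invariance, integrability, total mass\<close>

lemma sgn_orthogonal:
  fixes T :: "'a::euclidean_space \<Rightarrow> 'a"
  assumes "orthogonal_transformation T"
  shows "sgn (T x) = T (sgn x)"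
  using assms orthogonal_transformation_linear[OF assms]
  by (simp add: sgn_div_norm orthogonal_transformation_norm linear_cmul)

lemma integral_sphere_measure:
  fixes f :: "real^'n \<Rightarrow> real"
  assumes [measurable]: "f \<in> borel_measurable borel"
  shows "(\<integral>x. f x \<partial>sphere_measure) = (\<integral>x. f (sgn x) \<partial>uniform_measure lborel (ball 0 1))"
  unfolding sphere_measure_def by (rule integral_distr) measurable

lemma emeasure_uniform_unit_ball:
  "emeasure (uniform_measure lborel (ball (0::'a::euclidean_space) 1)) UNIV = 1"
  using emeasure_unit_ball[where 'a='a]
  by (subst emeasure_uniform_measure) (auto simp: ennreal_divide_self less_top)

lemma distr_uniform_ball_orthogonal:
  fixes T :: "'a::euclidean_space \<Rightarrow> 'a"
  assumes T: "orthogonal_transformation T"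
  shows "distr (uniform_measure lborel (ball 0 1)) borel T = uniform_measure lborel (ball 0 1)"
proof -
  note [measurable] = orthogonal_transformation_borel_measurable[OF T]
  let ?g = "\<lambda>x::'a. indicator (ball 0 1) x / emeasure lborel (ball (0::'a) 1)"
  have "density (distr lborel borel T) ?g = distr (density lborel (\<lambda>x. ?g (T x))) borel T"
    by (rule density_distr) (auto intro!: borel_measurable_divide_ennreal borel_measurable_indicator)
  moreover have "?g (T x) = ?g x" for x
    using T by (simp add: indicator_def orthogonal_transformation_norm dist_norm)
  ultimately show ?thesis
    unfolding uniform_measure_def distr_lborel_orthogonal[OF T] by simp
qed

text \<open>\<open>T\<close> commutes with \<open>sgn\<close> and preserves the uniform measure on
  the ball.\<close>

lemma integral_sphere_orthogonal:
  fixes f :: "real^'n \<Rightarrow> real" and T :: "real^'n \<Rightarrow> real^'n"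
  assumes T: "orthogonal_transformation T" and [measurable]: "f \<in> borel_measurable borel"
  shows "(\<integral>x. f (T x) \<partial>sphere_measure) = (\<integral>x. f x \<partial>sphere_measure)"
proof -
  note [measurable] = orthogonal_transformation_borel_measurable[OF T]
  have "(\<integral>x. f x \<partial>sphere_measure)
      = (\<integral>x. f (sgn x) \<partial>distr (uniform_measure lborel (ball 0 1)) borel T)"
    by (simp add: integral_sphere_measure distr_uniform_ball_orthogonal[OF T])
  also have "\<dots> = (\<integral>x. f (T (sgn x)) \<partial>uniform_measure lborel (ball 0 1))"
    by (subst integral_distr) (auto simp: sgn_orthogonal[OF T])
  also have "\<dots> = (\<integral>x. f (T x) \<partial>sphere_measure)"
    by (simp add: integral_sphere_measure)
  finally show ?thesis ..
qed

text \<open>\<open>sgn\<close> maps into the closed unit ball, including \<open>sgn 0 = 0\<close>,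
  and a continuous function is bounded there.\<close>

lemma integrable_sphere_measure:
  fixes f :: "real^'n \<Rightarrow> real"
  assumes f: "continuous_on UNIV f"
  shows "integrable sphere_measure f"
proof -
  have [measurable]: "f \<in> borel_measurable borel"
    using f by (rule borel_measurable_continuous_onI)
  interpret finite_measure "uniform_measure lborel (ball (0::real^'n) 1)"
    by standard (simp add: emeasure_uniform_unit_ball)
  have "compact (f ` cball 0 1)"
    by (intro compact_continuous_image continuous_on_subset[OF f]) auto
  then obtain K where K: "\<And>x. x \<in> cball 0 1 \<Longrightarrow> norm (f x) \<le> K"
    by (meson bounded_iff compact_imp_bounded image_eqI)
  have "integrable (uniform_measure lborel (ball 0 1)) (\<lambda>x. f (sgn x))"
    by (rule integrable_const_bound[of _ K]) (auto intro!: AE_I2 K[unfolded real_norm_def] simp: norm_sgn)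
  then show ?thesis
    unfolding sphere_measure_def by (subst integrable_distr_eq) auto
qed

text \<open>\<open>sgn x\<close> fails to be a unit vector only at \<open>x = 0\<close>, which is a
  null set.\<close>

lemma integral_sphere_norm:
  fixes f :: "real^'n \<Rightarrow> real"
  assumes [measurable]: "f \<in> borel_measurable borel"
  shows "(\<integral>x. f x * (norm x)\<^sup>2 \<partial>sphere_measure) = (\<integral>x. f x \<partial>sphere_measure)"
proof -
  have "AE x in lborel. x \<noteq> (0::real^'n)"
    by (rule AE_lborel_singleton)
  then have "AE x in uniform_measure lborel (ball 0 1). x \<noteq> (0::real^'n)"
    by (intro AE_uniform_measureI) auto
  then have "AE x in uniform_measure lborel (ball 0 1). f (sgn x) * (norm (sgn x))\<^sup>2 = f (sgn x)"
    by eventually_elim (simp add: norm_sgn)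
  then show ?thesis
    by (simp add: integral_sphere_measure integral_cong_AE)
qed

lemma measure_sphere_measure: "measure (sphere_measure :: (real^'n) measure) (space sphere_measure) = 1"
  unfolding sphere_measure_def
  by (subst measure_distr) (auto simp: measure_def emeasure_uniform_unit_ball)

section \<open>Moments of linear forms on the sphere\<close>

lemma integral_sphere_inner_power_norm_cong:
  fixes v w :: "real^'n"
  assumes "norm v = norm w"
  shows "(\<integral>x. (x \<bullet> v) ^ k \<partial>sphere_measure) = (\<integral>x. (x \<bullet> w) ^ k \<partial>sphere_measure)"
proof -
  obtain T where T: "orthogonal_transformation T" and "T v = w"
    using orthogonal_transformation_exists[OF assms] .
  then have "T x \<bullet> w = x \<bullet> v" for x
    unfolding orthogonal_transformation_def by auto
  then show ?thesis
    using integral_sphere_orthogonal[OF T, of "\<lambda>x. (x \<bullet> w) ^ k"] by simp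
qed

lemma integral_sphere_inner_odd_power:
  fixes v :: "real^'n"
  assumes "odd k"
  shows "(\<integral>x. (x \<bullet> v) ^ k \<partial>sphere_measure) = 0"
  using integral_sphere_inner_power_norm_cong[of v "- v" k] assms by simp

lemma integral_sphere_inner_power_scale:
  fixes v e :: "real^'n"
  assumes "norm e = 1"
  shows "(\<integral>x. (x \<bullet> v) ^ k \<partial>sphere_measure) = norm v ^ k * (\<integral>x. (x \<bullet> e) ^ k \<partial>sphere_measure)"
  using integral_sphere_inner_power_norm_cong[of v "norm v *\<^sub>R e" k] assms
  by (simp add: power_mult_distrib)

lemma coeff_one_plus_square_power_2:
  "coeff ([:1, 0, 1::real:] ^ k) 0 = 1 \<and> coeff ([:1, 0, 1::real:] ^ k) 2 = real k"
  by (induction k) (auto simp: numeral_2_eq_2)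

text \<open>Rotation invariance determines the integral of \<open>(x\<^sub>i + s x\<^sub>j)\<^bsup>2k+2\<^esup>\<close> up to one constant; this compares
  the coefficients of \<open>s\<^sup>2\<close>.\<close>

lemma integral_sphere_mixed_moment:
  fixes i j :: "'n::finite"
  assumes "i \<noteq> j"
  shows "real (2 * k + 1) * (\<integral>x. x $ i ^ (2 * k) * (x $ j)\<^sup>2 \<partial>sphere_measure)
    = (\<integral>x. x $ i ^ (2 * k + 2) \<partial>(sphere_measure :: (real^'n) measure))"
proof -
  let ?S = "sphere_measure :: (real^'n) measure"
  let ?K = "2 * k + 2"
  define I where "I = (\<integral>x. x $ i ^ ?K \<partial>?S)"
  define m where "m l = (\<integral>x. (x $ j) ^ l * (x $ i) ^ (?K - l) \<partial>?S)" for l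
  define p where "p = (\<Sum>l\<le>?K. monom (real (?K choose l) * m l) l)"
  \<comment> \<open>Both sides are the \<open>?K\<close>-th moment of \<open>x \<bullet> ?v\<close>:
    the left by binomial expansion, the right by scaling from a unit vector.\<close>
  have "poly p s = poly (smult I ([:1, 0, 1:] ^ (k + 1))) s" for s
  proof -
    let ?v = "axis i 1 + s *\<^sub>R axis j 1 :: real^'n"
    have "(norm ?v)\<^sup>2 = 1 + s\<^sup>2"
      using assms unfolding power2_norm_eq_inner
      by (simp add: inner_axis_axis inner_add_left inner_add_right power2_eq_square)
    then have norm: "norm ?v ^ ?K = (1 + s\<^sup>2) ^ (k + 1)"
      by (metis mult_Suc_right power_mult add.commute Suc_eq_plus1 add_2_eq_Suc)
    have "poly p s = (\<Sum>l\<le>?K. \<integral>x. real (?K choose l) * (s * x $ j) ^ l * (x $ i) ^ (?K - l) \<partial>?S)"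
      unfolding p_def poly_sum poly_monom m_def
      by (intro sum.cong refl) (simp add: power_mult_distrib mult_ac flip: integral_mult_right_zero)
    also have "\<dots> = (\<integral>x. (\<Sum>l\<le>?K. real (?K choose l) * (s * x $ j) ^ l * (x $ i) ^ (?K - l)) \<partial>?S)"
      by (rule Bochner_Integration.integral_sum[symmetric])
        (intro integrable_sphere_measure continuous_intros)
    also have "\<dots> = (\<integral>x. (x \<bullet> ?v) ^ ?K \<partial>?S)"
      by (simp add: binomial_ring[symmetric] inner_add_right inner_axis add.commute)
    also have "\<dots> = norm ?v ^ ?K * I"
      unfolding I_def using integral_sphere_inner_power_scale[of "axis i 1" ?v ?K]
      by (simp add: inner_axis)
    also have "\<dots> = poly (smult I ([:1, 0, 1:] ^ (k + 1))) s"
      unfolding norm by (simp add: poly_power power2_eq_square algebra_simps)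
    finally show ?thesis .
  qed
  then have "p = smult I ([:1, 0, 1:] ^ (k + 1))"
    by (simp add: poly_eq_poly_eq_iff[symmetric] fun_eq_iff)
  then have "coeff p 2 = I * real (k + 1)"
    using coeff_one_plus_square_power_2[of "k + 1"] by simp
  moreover have "coeff p 2 = real (?K choose 2) * m 2"
    unfolding p_def by (simp add: coeff_sum if_distrib numeral_2_eq_2 cong: if_cong)
  \<comment> \<open>The factor \<open>k + 1\<close> also appears in the coefficient of the
    right-hand polynomial and cancels.\<close>
  moreover have "real (?K choose 2) = real (k + 1) * real (2 * k + 1)"
    by (simp add: choose_two algebra_simps)
  ultimately have "real (2 * k + 1) * m 2 = I"
    by simp
  then show ?thesis
    by (simp add: m_def I_def mult.commute)
qed

text \<open>Insert \<open>(norm x)\<^sup>2\<close>, a sum of squared coordinates, into the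
  \<open>2 * k\<close>-th moment of coordinate \<open>i\<close>. The term \<open>j = i\<close> is
  the next even moment; each of the remaining terms is that moment divided by
  \<open>2 * k + 1\<close>.\<close>

lemma integral_sphere_inner_even_power_Suc:
  fixes v :: "real^'n"
  assumes "norm v = 1"
  shows "(\<integral>x. (x \<bullet> v) ^ (2 * k + 2) \<partial>sphere_measure)
    = (2 * real k + 1) / (real CARD('n) + 2 * real k) * (\<integral>x. (x \<bullet> v) ^ (2 * k) \<partial>sphere_measure)"
proof -
  let ?S = "sphere_measure :: (real^'n) measure"
  obtain i :: 'n where True by blast
  define I where "I l = (\<integral>x. x $ i ^ l \<partial>?S)" for l
  have v: "(\<integral>x. (x \<bullet> v) ^ l \<partial>?S) = I l" for l
    unfolding I_def
    using integral_sphere_inner_power_norm_cong[of v "axis i 1" l] assms by (simp add: inner_axis)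
  have "I (2 * k) = (\<integral>x. x $ i ^ (2 * k) * (norm x)\<^sup>2 \<partial>?S)"
    unfolding I_def by (rule integral_sphere_norm[symmetric])
      (intro borel_measurable_continuous_onI continuous_intros)
  also have "\<dots> = (\<integral>x. (\<Sum>j\<in>UNIV. x $ i ^ (2 * k) * (x $ j)\<^sup>2) \<partial>?S)"
    unfolding power2_norm_eq_inner inner_vec_def by (simp add: sum_distrib_left power2_eq_square)
  also have "\<dots> = (\<Sum>j\<in>UNIV. \<integral>x. x $ i ^ (2 * k) * (x $ j)\<^sup>2 \<partial>?S)"
    by (rule Bochner_Integration.integral_sum) (intro integrable_sphere_measure continuous_intros)
  also have "\<dots> = (\<integral>x. x $ i ^ (2 * k) * (x $ i)\<^sup>2 \<partial>?S)
      + (\<Sum>j\<in>UNIV - {i}. \<integral>x. x $ i ^ (2 * k) * (x $ j)\<^sup>2 \<partial>?S)"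
    by (rule sum.remove) auto
  also have "(\<integral>x. x $ i ^ (2 * k) * (x $ i)\<^sup>2 \<partial>?S) = I (2 * k + 2)"
    by (simp add: I_def flip: power_add)
  also have "(\<Sum>j\<in>UNIV - {i}. \<integral>x. x $ i ^ (2 * k) * (x $ j)\<^sup>2 \<partial>?S)
      = (\<Sum>j\<in>UNIV - {i}. I (2 * k + 2) / (2 * real k + 1))"
  proof (intro sum.cong refl)
    fix j assume "j \<in> UNIV - {i}"
    then show "(\<integral>x. x $ i ^ (2 * k) * (x $ j)\<^sup>2 \<partial>?S) = I (2 * k + 2) / (2 * real k + 1)"
      using integral_sphere_mixed_moment[of i j k] unfolding I_def
      by (auto simp: field_simps)
  qed
  also have "\<dots> = (real CARD('n) - 1) * I (2 * k + 2) / (2 * real k + 1)"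
    by (simp add: card_Diff_singleton of_nat_diff)
  finally have "I (2 * k) * (2 * real k + 1) = I (2 * k + 2) * (real CARD('n) + 2 * real k)"
    by (simp add: field_simps)
  moreover have "real CARD('n) + 2 * real k \<noteq> 0"
    by (metis add_nonneg_eq_0_iff mult_nonneg_nonneg of_nat_0_le_iff of_nat_eq_0_iff zero_le_numeral zero_less_card_finite less_irrefl)
  ultimately show ?thesis
    unfolding v by (simp add: field_simps)
qed

lemma integral_sphere_inner_powers:
  fixes v :: "real^'n"
  assumes v: "norm v = 1"
  defines "n \<equiv> real CARD('n)"
  shows "(\<integral>x. (x \<bullet> v) ^ 2 \<partial>sphere_measure) = 1 / n"
    and "(\<integral>x. (x \<bullet> v) ^ 4 \<partial>sphere_measure) = 3 / (n * (n + 2))"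
    and "(\<integral>x. (x \<bullet> v) ^ 6 \<partial>sphere_measure) = 15 / (n * (n + 2) * (n + 4))"
proof -
  show 2: "(\<integral>x. (x \<bullet> v) ^ 2 \<partial>sphere_measure) = 1 / n"
    using integral_sphere_inner_even_power_Suc[OF v, of 0]
    by (simp add: n_def measure_sphere_measure del: power2_eq_square flip: power2_eq_square)
  show 4: "(\<integral>x. (x \<bullet> v) ^ 4 \<partial>sphere_measure) = 3 / (n * (n + 2))"
    using integral_sphere_inner_even_power_Suc[OF v, of 1] 2 by (simp add: n_def)
  show "(\<integral>x. (x \<bullet> v) ^ 6 \<partial>sphere_measure) = 15 / (n * (n + 2) * (n + 4))"
    using integral_sphere_inner_even_power_Suc[OF v, of 2] 4 by (simp add: n_def)
qed

section \<open>Powers of linear forms as polynomials of bounded degree\<close>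

lemma finite_exponents_le: "finite {a :: 'n::finite \<Rightarrow> nat. sum a UNIV \<le> t}"
proof (rule finite_subset)
  show "{a :: 'n \<Rightarrow> nat. sum a UNIV \<le> t} \<subseteq> PiE UNIV (\<lambda>_. {..t})"
    using member_le_sum[of _ "UNIV :: 'n set"] by (auto intro: order_trans[rotated])
qed (intro finite_PiE, auto)

lemma polynomial_of_degree_le_const: "polynomial_of_degree_le t (\<lambda>_ :: real^'n. c)"
proof -
  have "(\<Sum>a | sum a UNIV \<le> t. (if a = (\<lambda>_. 0) then c else 0) * (\<Prod>i\<in>UNIV. x $ i ^ a i)) = c"
    for x :: "real^'n"
    by (subst sum.remove[of _ "\<lambda>_. 0"]) (auto simp: finite_exponents_le)
  then show ?thesis
    unfolding polynomial_of_degree_le_def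
    by (intro exI[of _ "\<lambda>a. if a = (\<lambda>_. 0) then c else 0"]) simp
qed

lemma polynomial_of_degree_le_add:
  assumes "polynomial_of_degree_le t f" "polynomial_of_degree_le t g"
  shows "polynomial_of_degree_le t (\<lambda>x. f x + g x)"
proof -
  from assms obtain c d where
    "f = (\<lambda>x. \<Sum>a | sum a UNIV \<le> t. c a * (\<Prod>i\<in>UNIV. x $ i ^ a i))"
    "g = (\<lambda>x. \<Sum>a | sum a UNIV \<le> t. d a * (\<Prod>i\<in>UNIV. x $ i ^ a i))"
    unfolding polynomial_of_degree_le_def by blast
  then show ?thesis
    unfolding polynomial_of_degree_le_def
    by (intro exI[of _ "\<lambda>a. c a + d a"]) (simp add: sum.distrib algebra_simps)
qed

lemma polynomial_of_degree_le_sum: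
  assumes "\<And>s. s \<in> S \<Longrightarrow> polynomial_of_degree_le t (f s)"
  shows "polynomial_of_degree_le t (\<lambda>x. \<Sum>s\<in>S. f s x)"
  using assms
  by (induction S rule: infinite_finite_induct)
    (auto intro: polynomial_of_degree_le_const polynomial_of_degree_le_add)

text \<open>A linear form is a sum of terms \<open>r * x $ k\<close>, so its powers are built from
  this step, which raises the exponent of coordinate \<open>k\<close> by one.\<close>

lemma polynomial_of_degree_le_mult_coordinate:
  fixes f :: "real^'n \<Rightarrow> real"
  assumes "polynomial_of_degree_le t f"
  shows "polynomial_of_degree_le (Suc t) (\<lambda>x. r * x $ k * f x)"
proof -
  from assms obtain c where
    f: "f = (\<lambda>x. \<Sum>a | sum a UNIV \<le> t. c a * (\<Prod>i\<in>UNIV. x $ i ^ a i))"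
    unfolding polynomial_of_degree_le_def by blast
  define up where "up a = a(k := Suc (a k))" for a :: "'n \<Rightarrow> nat"
  \<comment> \<open>The coefficients carried along \<open>up\<close>; exponent vectors with
    \<open>a k = 0\<close> lie outside its range and get 0.\<close>
  define c' where "c' a = (if a k = 0 then 0 else r * c (a(k := a k - 1)))" for a :: "'n \<Rightarrow> nat"
  have sum_up: "sum (up a) UNIV = Suc (sum a UNIV)" for a
    by (simp add: up_def sum.remove[of _ k])
  have prod_up: "(\<Prod>i\<in>UNIV. x $ i ^ up a i) = x $ k * (\<Prod>i\<in>UNIV. x $ i ^ a i)" for x :: "real^'n" and a
    by (simp add: up_def prod.remove[of _ k])
  have c'_up: "c' (up a) = r * c a" for a
    by (simp add: c'_def up_def)
  have img: "{a. sum a UNIV \<le> Suc t \<and> a k \<noteq> 0} = up ` {a. sum a UNIV \<le> t}"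
  proof (intro equalityI subsetI)
    fix b assume b: "b \<in> {a. sum a UNIV \<le> Suc t \<and> a k \<noteq> 0}"
    then have "b = up (b(k := b k - 1))" by (auto simp: up_def)
    then show "b \<in> up ` {a. sum a UNIV \<le> t}"
      using b sum_up[of "b(k := b k - 1)"] by auto
  qed (auto simp: sum_up, auto simp: up_def)
  have "inj up"
    by (rule inj_on_inverseI[of _ "\<lambda>a. a(k := a k - 1)"]) (simp add: up_def)
  have "r * x $ k * f x = (\<Sum>b | sum b UNIV \<le> Suc t. c' b * (\<Prod>i\<in>UNIV. x $ i ^ b i))" for x
  proof -
    have "r * x $ k * f x = (\<Sum>a | sum a UNIV \<le> t. c' (up a) * (\<Prod>i\<in>UNIV. x $ i ^ up a i))"
      unfolding f c'_up prod_up by (simp add: sum_distrib_left mult_ac)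
    also have "\<dots> = (\<Sum>b | sum b UNIV \<le> Suc t \<and> b k \<noteq> 0. c' b * (\<Prod>i\<in>UNIV. x $ i ^ b i))"
      unfolding img by (subst sum.reindex) (auto intro: inj_on_subset[OF \<open>inj up\<close>])
    also have "\<dots> = (\<Sum>b | sum b UNIV \<le> Suc t. c' b * (\<Prod>i\<in>UNIV. x $ i ^ b i))"
      by (rule sum.mono_neutral_left) (auto simp: finite_exponents_le c'_def)
    finally show ?thesis .
  qed
  then show ?thesis
    unfolding polynomial_of_degree_le_def by blast
qed

text \<open>These are the functions on which the design property is tested.\<close>

lemma polynomial_of_degree_le_inner_power:
  fixes v :: "real^'n"
  assumes "k \<le> t"
  shows "polynomial_of_degree_le t (\<lambda>x. (x \<bullet> v) ^ k)"
  using assms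
proof (induction k arbitrary: t)
  case 0
  then show ?case by (simp add: polynomial_of_degree_le_const)
next
  case (Suc k)
  then obtain s where s: "t = Suc s" "k \<le> s" by (cases t) auto
  have "(\<lambda>x :: real^'n. (x \<bullet> v) ^ Suc k) = (\<lambda>x. \<Sum>i\<in>UNIV. v $ i * x $ i * (x \<bullet> v) ^ k)"
    by (simp add: inner_vec_def sum_distrib_right mult.commute)
  then show ?case
    unfolding s(1) using Suc.IH[OF s(2)]
    by (simp only:) (intro polynomial_of_degree_le_sum polynomial_of_degree_le_mult_coordinate)
qed

section \<open>The Bose--Mesner algebra\<close>

lemma matrix_mult_add_left: "(M + N) ** (B :: real^'x^'x) = M ** B + N ** B"
  by (simp add: vec_eq_iff matrix_matrix_mult_def algebra_simps sum.distrib)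

lemma matrix_mult_scaleR_left: "(c *\<^sub>R M) ** (B :: real^'x^'x) = c *\<^sub>R (M ** B)"
  by (simp add: vec_eq_iff matrix_matrix_mult_def sum_distrib_left mult.assoc)

lemma matrix_mult_scaleR_right: "(B :: real^'x^'x) ** (c *\<^sub>R M) = c *\<^sub>R (B ** M)"
  by (simp add: vec_eq_iff matrix_matrix_mult_def sum_distrib_left mult_ac)

lemma matrix_mult_zero_left: "0 ** (B :: real^'x^'x) = 0"
  by (simp add: vec_eq_iff matrix_matrix_mult_def)

lemma matrix_mult_zero_right: "(B :: real^'x^'x) ** 0 = 0"
  by (simp add: vec_eq_iff matrix_matrix_mult_def)

lemma matrix_mult_sum_left: "(\<Sum>i\<in>S. f i) ** (B :: real^'x^'x) = (\<Sum>i\<in>S. f i ** B)"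
  by (induction S rule: infinite_finite_induct)
    (simp_all add: matrix_mult_zero_left matrix_mult_add_left)

lemma hadamard_nth [simp]: "hadamard M N $ x $ y = M $ x $ y * N $ x $ y"
  by (simp add: hadamard_def)

lemma hadamard_sum_scaleR_right: "hadamard M (\<Sum>i\<in>S. c i *\<^sub>R f i) = (\<Sum>i\<in>S. c i *\<^sub>R hadamard M (f i))"
  by (simp add: vec_eq_iff sum_distrib_left mult_ac)

lemma hadamard_scaleR_left: "hadamard (c *\<^sub>R M) N = c *\<^sub>R hadamard M N"
  by (simp add: vec_eq_iff)

section \<open>The adjacency algebra and its entrywise description\<close>

locale assoc_scheme =
  fixes d :: nat and R :: "nat \<Rightarrow> ('x::finite \<times> 'x) set" and E :: "nat \<Rightarrow> real^'x^'x"
  assumes scheme: "symmetric_association_scheme d R"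
    and idempotents: "primitive_idempotents d R E"
begin

abbreviation BM :: "(real^'x^'x) set" where
  "BM \<equiv> bose_mesner d R"

definition rel_index :: "'x \<Rightarrow> 'x \<Rightarrow> nat" where
  "rel_index x y = (THE i. i \<le> d \<and> (x, y) \<in> R i)"

lemma R_disjoint: "i \<le> d \<Longrightarrow> j \<le> d \<Longrightarrow> p \<in> R i \<Longrightarrow> p \<in> R j \<Longrightarrow> i = j"
  using scheme unfolding symmetric_association_scheme_def disjoint_family_on_def
  by (metis IntI atMost_iff empty_iff)

lemma R_sym: "i \<le> d \<Longrightarrow> (x, y) \<in> R i \<Longrightarrow> (y, x) \<in> R i"
  using scheme unfolding symmetric_association_scheme_def by (meson symD)

lemma R_0: "R 0 = Id"
  using scheme unfolding symmetric_association_scheme_def by simp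

lemma rel_index: "rel_index x y \<le> d \<and> (x, y) \<in> R (rel_index x y)"
proof -
  have "(x, y) \<in> (\<Union>i\<le>d. R i)"
    using scheme unfolding symmetric_association_scheme_def by simp
  then obtain i where "i \<le> d \<and> (x, y) \<in> R i" by auto
  then show ?thesis
    unfolding rel_index_def by (rule theI) (use R_disjoint \<open>i \<le> d \<and> (x, y) \<in> R i\<close> in metis)
qed

lemma rel_iff: "i \<le> d \<Longrightarrow> (x, y) \<in> R i \<longleftrightarrow> rel_index x y = i"
  using rel_index[of x y] R_disjoint by metis

lemma rel_index_commute: "rel_index x y = rel_index y x"
  using rel_index[of x y] rel_iff[of "rel_index x y" y x] R_sym by simp

lemma rel_index_eq_0_iff: "rel_index x y = 0 \<longleftrightarrow> x = y"
  using rel_iff[of 0 x y] by (simp add: R_0)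

lemma adj_matrix_nth: "i \<le> d \<Longrightarrow> adj_matrix (R i) $ x $ y = (if rel_index x y = i then 1 else 0)"
  by (simp add: adj_matrix_def rel_iff)

text \<open>This description reduces Hadamard closure, symmetry and the constant diagonal to facts
  about \<open>m\<close> and \<open>rel_index\<close>.\<close>

lemma BM_iff: "M \<in> BM \<longleftrightarrow> (\<exists>m. \<forall>x y. M $ x $ y = m (rel_index x y))"
proof
  assume "M \<in> BM"
  then show "\<exists>m. \<forall>x y. M $ x $ y = m (rel_index x y)"
    unfolding bose_mesner_def
  proof (induction rule: span_induct_alt)
    case base
    show ?case by (rule exI[of _ "\<lambda>_. 0"]) simp
  next
    case (step c B N)
    then obtain i m where "i \<le> d" "B = adj_matrix (R i)" "\<forall>x y. N $ x $ y = m (rel_index x y)"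
      by auto
    then show ?case
      by (intro exI[of _ "\<lambda>j. c * (if j = i then 1 else 0) + m j"]) (simp add: adj_matrix_nth)
  qed
next
  assume "\<exists>m. \<forall>x y. M $ x $ y = m (rel_index x y)"
  then obtain m where "\<forall>x y. M $ x $ y = m (rel_index x y)" ..
  then have "M = (\<Sum>i\<le>d. m i *\<^sub>R adj_matrix (R i))"
    using rel_index by (simp add: vec_eq_iff adj_matrix_nth if_distrib cong: if_cong)
  then show "M \<in> BM"
    unfolding bose_mesner_def by (simp only:) (intro span_sum span_scale span_base imageI, simp)
qed

lemma BM_entry_cong: "M \<in> BM \<Longrightarrow> rel_index x y = rel_index x' y' \<Longrightarrow> M $ x $ y = M $ x' $ y'"
  unfolding BM_iff by metis

lemma BM_diag_cong: "M \<in> BM \<Longrightarrow> M $ x $ x = M $ y $ y"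
  using BM_entry_cong[of M x x y y] rel_index_eq_0_iff by metis

lemma BM_symmetric: "M \<in> BM \<Longrightarrow> M $ x $ y = M $ y $ x"
  using BM_entry_cong rel_index_commute by blast

lemma BM_subspace: "subspace BM"
  unfolding bose_mesner_def by (rule subspace_span)

lemmas BM_add = subspace_add[OF BM_subspace]
  and BM_diff = subspace_diff[OF BM_subspace]
  and BM_scaleR = subspace_scale[OF BM_subspace]
  and BM_sum = subspace_sum[OF BM_subspace]

lemma BM_hadamard:
  assumes "M \<in> BM" "N \<in> BM" shows "hadamard M N \<in> BM"
proof -
  from assms obtain m n where "\<forall>x y. M $ x $ y = m (rel_index x y)" "\<forall>x y. N $ x $ y = n (rel_index x y)"
    unfolding BM_iff by blast
  then show ?thesis
    unfolding BM_iff by (intro exI[of _ "\<lambda>i. m i * n i"]) simp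
qed

lemma BM_mat_1: "mat 1 \<in> BM"
  unfolding BM_iff by (rule exI[of _ "\<lambda>i. if i = 0 then 1 else 0"]) (simp add: mat_def rel_index_eq_0_iff)

lemma BM_adj: "i \<le> d \<Longrightarrow> adj_matrix (R i) \<in> BM"
  unfolding bose_mesner_def by (auto intro: span_base)

lemma BM_mult:
  assumes "M \<in> BM" "N \<in> BM" shows "M ** N \<in> BM"
  using assms(1) unfolding bose_mesner_def
proof (induction rule: span_induct_alt)
  case base
  show ?case using subspace_0[OF BM_subspace] by (simp add: matrix_mult_zero_left bose_mesner_def)
next
  case (step c B M)
  then obtain i where i: "i \<le> d" "B = adj_matrix (R i)" by auto
  have "B ** N \<in> BM"
    using assms(2) unfolding bose_mesner_def
  proof (induction rule: span_induct_alt)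
    case base
    show ?case using subspace_0[OF BM_subspace] by (simp add: matrix_mult_zero_right bose_mesner_def)
  next
    case (step c C N)
    then obtain j where "j \<le> d" "C = adj_matrix (R j)" by auto
    then have "B ** C \<in> BM"
      using scheme i unfolding symmetric_association_scheme_def by blast
    then show ?case
      using step BM_add BM_scaleR
      by (simp add: matrix_add_ldistrib matrix_mult_scaleR_right flip: bose_mesner_def)
  qed
  then show ?case
    using step BM_add BM_scaleR
    by (simp add: matrix_mult_add_left matrix_mult_scaleR_left flip: bose_mesner_def)
qed

text \<open>\<open>M\<close>, \<open>N\<close> and \<open>M ** N\<close> are all symmetric, and
  transposing a product reverses its factors.\<close>

lemma BM_commute:
  assumes "M \<in> BM" "N \<in> BM" shows "M ** N = N ** M"
proof -
  have "(M ** N) $ x $ y = (N ** M) $ x $ y" for x y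
  proof -
    have "(M ** N) $ x $ y = (M ** N) $ y $ x"
      using BM_mult[OF assms] by (rule BM_symmetric)
    also have "\<dots> = (N ** M) $ x $ y"
      using BM_symmetric[OF assms(1)] BM_symmetric[OF assms(2)]
      by (simp add: matrix_matrix_mult_def mult.commute)
    finally show ?thesis .
  qed
  then show ?thesis by (simp add: vec_eq_iff)
qed

section \<open>The primitive idempotents and the eigenvalues on them\<close>

lemma E_bij: "bij_betw E {..d} {F. primitive_idempotent_in BM F}"
  using idempotents unfolding primitive_idempotents_def by blast

lemma E_primitive: "i \<le> d \<Longrightarrow> primitive_idempotent_in BM (E i)"
  using bij_betwE[OF E_bij] by blast

lemma E_BM: "i \<le> d \<Longrightarrow> E i \<in> BM"
  and E_nonzero: "i \<le> d \<Longrightarrow> E i \<noteq> 0"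
  and E_idem: "i \<le> d \<Longrightarrow> E i ** E i = E i"
  using E_primitive unfolding primitive_idempotent_in_def by blast+

lemma E_inj: "inj_on E {..d}"
  using E_bij by (rule bij_betw_imp_inj_on)

text \<open>Otherwise \<open>E i ** E j\<close> and \<open>E i - E i ** E j\<close> would split
  \<open>E i\<close> into nonzero orthogonal idempotents, against primitivity.\<close>

lemma E_mult_absorb:
  assumes "i \<le> d" "j \<le> d" "E i ** E j \<noteq> 0"
  shows "E i ** E j = E i"
proof (rule ccontr)
  assume ne: "E i ** E j \<noteq> E i"
  let ?F = "E i ** E j" and ?G = "E i - E i ** E j"
  have comm: "E j ** E i = E i ** E j" using BM_commute E_BM assms by blast
  have diff: "(M - N) ** B = M ** B - N ** B" "B ** (M - N) = B ** M - B ** N" for M N B :: "real^'x^'x"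
    using matrix_mult_add_left[of M "- 1 *\<^sub>R N" B] matrix_add_ldistrib[of B M "- 1 *\<^sub>R N"]
    unfolding matrix_mult_scaleR_left matrix_mult_scaleR_right by simp_all
  have 1: "?F ** ?F = ?F"
    by (metis E_idem assms(1,2) comm matrix_mul_assoc)
  have 2: "E i ** ?F = ?F" "?F ** E i = ?F"
    by (metis E_idem assms(1,2) comm matrix_mul_assoc)+
  have "?F \<in> BM" "?G \<in> BM" using BM_mult BM_diff E_BM assms by blast+
  moreover have "?G ** ?G = ?G" "?F ** ?G = 0" "?G ** ?F = 0"
    using 1 2 E_idem[OF assms(1)] by (simp_all add: diff)
  moreover have "?G \<noteq> 0" "E i = ?F + ?G" using ne by auto
  ultimately show False
    using E_primitive[OF assms(1)] assms(3) 1 unfolding primitive_idempotent_in_def by blast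
qed

text \<open>A nonzero product is absorbed from both sides, so commutativity would give
  \<open>E i = E j\<close>.\<close>

lemma E_orthogonal:
  assumes "i \<le> d" "j \<le> d" "i \<noteq> j"
  shows "E i ** E j = 0"
proof (rule ccontr)
  assume "E i ** E j \<noteq> 0"
  then have "E i = E j"
    using E_mult_absorb[of i j] E_mult_absorb[of j i] BM_commute[of "E i" "E j"] E_BM assms by metis
  then show False using E_inj assms unfolding inj_on_def by blast
qed

lemma sum_scaleR_E_mult_E: "j \<le> d \<Longrightarrow> (\<Sum>i\<le>d. c i *\<^sub>R E i) ** E j = c j *\<^sub>R E j"
proof -
  assume j: "j \<le> d"
  have "(\<Sum>i\<le>d. c i *\<^sub>R E i) ** E j = (\<Sum>i\<le>d. if i = j then c j *\<^sub>R E j else 0)"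
    unfolding matrix_mult_sum_left
    by (rule sum.cong) (use j E_orthogonal E_idem in \<open>auto simp: matrix_mult_scaleR_left\<close>)
  then show ?thesis using j by simp
qed

lemma E_independent: "independent (E ` {..d})"
proof -
  have "c j = 0" if "(\<Sum>i\<le>d. c i *\<^sub>R E i) = 0" "j \<le> d" for c j
    using sum_scaleR_E_mult_E[OF that(2), of c] that E_nonzero by (simp add: matrix_mult_zero_left)
  then have "u (E j) = 0" if "(\<Sum>v\<in>E ` {..d}. u v *\<^sub>R v) = 0" "j \<le> d" for u j
    using that by (simp add: sum.reindex[OF E_inj])
  then show ?thesis
    by (intro independent_if_scalars_zero) auto
qed

text \<open>A dimension count: \<open>d + 1\<close> adjacency matrices span the algebra, and it
  contains \<open>d + 1\<close> independent idempotents.\<close>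

lemma BM_span_E: "BM = span (E ` {..d})"
proof
  have "dim BM \<le> card ((\<lambda>k. adj_matrix (R k)) ` {..d})"
    unfolding bose_mesner_def dim_span by (rule dim_le_card') simp
  also have "\<dots> \<le> card {..d}" by (rule card_image_le) simp
  also have "\<dots> = card (E ` {..d})" using card_image[OF E_inj] by simp
  finally show "BM \<subseteq> span (E ` {..d})"
    using E_independent E_BM by (intro card_ge_dim_independent) auto
  show "span (E ` {..d}) \<subseteq> BM"
    using BM_subspace E_BM by (intro span_minimal) auto
qed

text \<open>The eigenvalue of \<open>M\<close> on the column space of \<open>E i\<close>. It is an
  arbitrary value if no such \<open>c\<close> exists; for \<open>M \<in> BM\<close> and
  \<open>i \<le> d\<close> one does.\<close>

definition ev :: "real^'x^'x \<Rightarrow> nat \<Rightarrow> real" where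
  "ev M i = (SOME c. M ** E i = c *\<^sub>R E i)"

lemma ev_unique:
  assumes "i \<le> d" "M ** E i = c *\<^sub>R E i"
  shows "ev M i = c"
proof -
  have "M ** E i = ev M i *\<^sub>R E i" unfolding ev_def using assms(2) by (rule someI)
  then show ?thesis using assms E_nonzero by simp
qed

lemma ev_sum_scaleR_E: "i \<le> d \<Longrightarrow> ev (\<Sum>j\<le>d. c j *\<^sub>R E j) i = c i"
  by (intro ev_unique sum_scaleR_E_mult_E)

lemma BM_decomp:
  assumes "M \<in> BM"
  shows "M = (\<Sum>i\<le>d. ev M i *\<^sub>R E i)"
proof -
  obtain u where "M = (\<Sum>v\<in>E ` {..d}. u v *\<^sub>R v)"
    using assms unfolding BM_span_E by (subst (asm) span_finite) auto
  then have M: "M = (\<Sum>i\<le>d. u (E i) *\<^sub>R E i)"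
    by (simp add: sum.reindex[OF E_inj])
  have "ev M i = u (E i)" if "i \<le> d" for i
    unfolding M using that by (rule ev_sum_scaleR_E)
  then show ?thesis by (subst M) (rule sum.cong, auto)
qed

lemma ev_eigen: "M \<in> BM \<Longrightarrow> i \<le> d \<Longrightarrow> M ** E i = ev M i *\<^sub>R E i"
  by (subst BM_decomp, assumption, rule sum_scaleR_E_mult_E)

lemma ev_add: "M \<in> BM \<Longrightarrow> N \<in> BM \<Longrightarrow> i \<le> d \<Longrightarrow> ev (M + N) i = ev M i + ev N i"
  by (rule ev_unique) (simp_all add: matrix_mult_add_left ev_eigen scaleR_add_left)

lemma ev_scaleR: "M \<in> BM \<Longrightarrow> i \<le> d \<Longrightarrow> ev (c *\<^sub>R M) i = c * ev M i"
  by (rule ev_unique) (simp_all add: matrix_mult_scaleR_left ev_eigen)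

lemma ev_mult: "M \<in> BM \<Longrightarrow> N \<in> BM \<Longrightarrow> i \<le> d \<Longrightarrow> ev (M ** N) i = ev M i * ev N i"
  by (rule ev_unique)
    (simp_all add: ev_eigen matrix_mult_scaleR_right flip: matrix_mul_assoc)

lemma ev_mat_1: "i \<le> d \<Longrightarrow> ev (mat 1) i = 1"
  by (rule ev_unique) simp_all

lemma ev_E: "i \<le> d \<Longrightarrow> j \<le> d \<Longrightarrow> ev (E j) i = (if i = j then 1 else 0)"
  by (rule ev_unique) (auto simp: E_idem E_orthogonal)

lemma sum_E: "(\<Sum>i\<le>d. E i) = mat 1"
  using BM_decomp[OF BM_mat_1] by (simp add: ev_mat_1)

text \<open>A diagonal entry of a symmetric idempotent is the sum of squares of its row. The
  diagonal is constant, so a zero on it would make all of \<open>E i\<close> vanish.\<close>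

lemma E_diag_pos:
  assumes "i \<le> d"
  shows "E i $ x $ x > 0"
proof -
  have sq: "E i $ y $ y = (\<Sum>z\<in>UNIV. (E i $ y $ z)\<^sup>2)" for y
  proof -
    have "E i $ y $ y = (E i ** E i) $ y $ y" by (simp add: E_idem assms)
    also have "\<dots> = (\<Sum>z\<in>UNIV. (E i $ y $ z)\<^sup>2)"
      unfolding matrix_matrix_mult_def power2_eq_square
      by (simp, intro sum.cong refl arg_cong2[of _ _ _ _ "(*)"] BM_symmetric E_BM assms)
    finally show ?thesis .
  qed
  have "E i $ x $ x \<noteq> 0"
  proof
    assume "E i $ x $ x = 0"
    then have "E i $ y $ y = 0" for y using BM_diag_cong[OF E_BM[OF assms]] by metis
    then have "E i $ y $ z = 0" for y z
      using sq[of y] by (simp add: sum_nonneg_eq_0_iff)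
    then show False using E_nonzero[OF assms] by (simp add: vec_eq_iff)
  qed
  moreover have "E i $ x $ x \<ge> 0" unfolding sq by (intro sum_nonneg) simp
  ultimately show ?thesis by simp
qed

lemma BM_eqI: "M \<in> BM \<Longrightarrow> N \<in> BM \<Longrightarrow> (\<And>i. i \<le> d \<Longrightarrow> ev M i = ev N i) \<Longrightarrow> M = N"
  by (subst BM_decomp, assumption, subst (2) BM_decomp, assumption, rule sum.cong) auto

end

section \<open>Q-polynomial schemes\<close>

text \<open>\<open>\<theta>\<close> is the dual sequence of the theorem; the eigenvalues of the
  graph appear later as \<open>ev_A\<close>.\<close>

locale q_polynomial_scheme = assoc_scheme d R E
  for d :: nat and R :: "nat \<Rightarrow> ('x::finite \<times> 'x) set" and E :: "nat \<Rightarrow> real^'x^'x" +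
  fixes q :: "nat \<Rightarrow> nat \<Rightarrow> nat \<Rightarrow> real" and \<theta> :: "nat \<Rightarrow> real"
  assumes d_pos: "d \<ge> 1"
    and krein: "krein_parameters d E q"
    and Q_poly: "Q_polynomial d q"
    and E_1: "E 1 = (1 / real CARD('x)) *\<^sub>R (\<Sum>j\<le>d. \<theta> j *\<^sub>R adj_matrix (R j))"
    and \<theta>_0_pos: "\<theta> 0 > 0"
begin

definition G :: "real^'x^'x" where
  "G = (real CARD('x) / \<theta> 0) *\<^sub>R E 1"

definition G_pow :: "nat \<Rightarrow> real^'x^'x" where
  "G_pow r = (\<chi> x y. (G $ x $ y) ^ r)"

text \<open>The coefficients of \<open>hadamard G (E i)\<close> in the idempotents: the factor
  \<open>CARD('x)\<close> of \<open>G\<close> cancels the one in the Krein relation.\<close>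

definition \<kappa> :: "nat \<Rightarrow> nat \<Rightarrow> real" where
  "\<kappa> i k = q 1 i k / \<theta> 0"

lemma G_pow_nth [simp]: "G_pow r $ x $ y = (G $ x $ y) ^ r"
  by (simp add: G_pow_def)

lemma G_BM: "G \<in> BM"
  unfolding G_def using E_BM d_pos by (intro BM_scaleR) auto

lemma G_nth: "G $ x $ y = \<theta> (rel_index x y) / \<theta> 0"
proof -
  have "(\<Sum>j\<le>d. \<theta> j * adj_matrix (R j) $ x $ y) = (\<Sum>j\<le>d. if j = rel_index x y then \<theta> j else 0)"
    by (rule sum.cong) (auto simp: adj_matrix_nth)
  then show ?thesis
    using rel_index[of x y] unfolding G_def E_1 by simp
qed

lemma G_diag: "G $ x $ x = 1"
  using \<theta>_0_pos rel_index_eq_0_iff[of x x] by (simp add: G_nth)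

lemma hadamard_G_E: "i \<le> d \<Longrightarrow> hadamard G (E i) = (\<Sum>k\<le>d. \<kappa> i k *\<^sub>R E k)"
  using krein d_pos unfolding krein_parameters_def G_def hadamard_scaleR_left \<kappa>_def
  by (simp add: scaleR_sum_right)

lemma \<kappa>_eq_0: "i \<le> d \<Longrightarrow> k \<le> d \<Longrightarrow> i + 1 < k \<or> k + 1 < i \<Longrightarrow> \<kappa> i k = 0"
  using Q_poly unfolding Q_polynomial_def \<kappa>_def by auto

lemma \<kappa>_Suc_neq_0: "i < d \<Longrightarrow> \<kappa> i (Suc i) \<noteq> 0"
  using Q_poly \<theta>_0_pos unfolding Q_polynomial_def \<kappa>_def by fastforce

lemma ev_hadamard_G:
  assumes "M \<in> BM" "k \<le> d"
  shows "ev (hadamard G M) k = (\<Sum>i\<le>d. ev M i * \<kappa> i k)"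
proof -
  have "hadamard G M = (\<Sum>i\<le>d. ev M i *\<^sub>R (\<Sum>k\<le>d. \<kappa> i k *\<^sub>R E k))"
    by (subst BM_decomp[OF assms(1)]) (simp add: hadamard_sum_scaleR_right hadamard_G_E)
  also have "\<dots> = (\<Sum>k\<le>d. \<Sum>i\<le>d. (ev M i * \<kappa> i k) *\<^sub>R E k)"
    unfolding scaleR_sum_right by (subst sum.swap) simp
  also have "\<dots> = (\<Sum>k\<le>d. (\<Sum>i\<le>d. ev M i * \<kappa> i k) *\<^sub>R E k)"
    by (simp add: scaleR_sum_left)
  finally show ?thesis using ev_sum_scaleR_E[OF assms(2)] by simp
qed

text \<open>\<open>G\<close> has unit diagonal, so Hadamard multiplication by it fixes the identity,
  whose eigenvalues are all 1.\<close>

lemma sum_\<kappa>: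
  assumes "k \<le> d"
  shows "(\<Sum>i\<le>d. \<kappa> i k) = 1"
proof -
  have "hadamard G (mat 1) = mat 1" by (simp add: vec_eq_iff mat_def G_diag)
  then show ?thesis
    using ev_hadamard_G[OF BM_mat_1 assms] assms by (simp add: ev_mat_1)
qed

section \<open>Entrywise powers of the Gram matrix\<close>

lemma G_pow_0: "G_pow 0 = real CARD('x) *\<^sub>R E 0"
  using idempotents by (simp add: primitive_idempotents_def all_ones_def vec_eq_iff)

lemma G_pow_Suc: "G_pow (Suc r) = hadamard G (G_pow r)"
  by (simp add: vec_eq_iff)

lemma hadamard_G_linear: "hadamard G (c *\<^sub>R M + N) = c *\<^sub>R hadamard G M + hadamard G N"
  by (simp add: vec_eq_iff algebra_simps)

text \<open>\<open>\<kappa>\<close> is tridiagonal, so multiplying by \<open>G\<close> raises the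
  index by at most one.\<close>

lemma hadamard_G_span_E:
  assumes "M \<in> span (E ` {..r})" "r < d"
  shows "hadamard G M \<in> span (E ` {..Suc r})"
  using assms(1)
proof (induction rule: span_induct_alt)
  case base
  have "hadamard G 0 = 0" by (simp add: vec_eq_iff)
  then show ?case by (simp add: span_zero)
next
  case (step c B M)
  then obtain i where i: "i \<le> r" "B = E i" by auto
  have "hadamard G B \<in> span (E ` {..Suc r})"
    unfolding i(2) using i(1) \<open>r < d\<close>
  proof (subst hadamard_G_E)
    show "(\<Sum>k\<le>d. \<kappa> i k *\<^sub>R E k) \<in> span (E ` {..Suc r})"
    proof (rule span_sum)
      fix k assume "k \<in> {..d}"
      then show "\<kappa> i k *\<^sub>R E k \<in> span (E ` {..Suc r})"
        using \<kappa>_eq_0[of i k] i(1) \<open>r < d\<close>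
        by (cases "k \<le> Suc r") (auto intro: span_scale span_base span_zero)
    qed
  qed simp
  then show ?case
    unfolding hadamard_G_linear using step.IH by (intro span_add span_scale)
qed

lemma G_pow_span_E: "r \<le> d \<Longrightarrow> G_pow r \<in> span (E ` {..r})"
proof (induction r)
  case 0
  show ?case unfolding G_pow_0 by (intro span_scale span_base) auto
next
  case (Suc r)
  then show ?case unfolding G_pow_Suc by (intro hadamard_G_span_E) auto
qed

lemma hadamard_G_span_G_pow:
  assumes "M \<in> span (G_pow ` {..r})"
  shows "hadamard G M \<in> span (G_pow ` {..Suc r})"
  using assms
proof (induction rule: span_induct_alt)
  case base
  have "hadamard G 0 = 0" by (simp add: vec_eq_iff)
  then show ?case by (simp add: span_zero)
next
  case (step c B M)
  then obtain i where i: "i \<le> r" "B = G_pow i" by auto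
  then have "hadamard G B \<in> span (G_pow ` {..Suc r})"
    unfolding i(2) G_pow_Suc[symmetric] by (intro span_base) auto
  then show ?case
    unfolding hadamard_G_linear using step.IH by (intro span_add span_scale)
qed

text \<open>Solve the expansion of \<open>hadamard G (E m)\<close> for its top term
  \<open>E (Suc m)\<close>, whose coefficient is nonzero.\<close>

lemma E_span_G_pow: "l \<le> d \<Longrightarrow> E l \<in> span (G_pow ` {..l})"
proof (induction l rule: less_induct)
  case (less l)
  show ?case
  proof (cases l)
    case 0
    have "E 0 = (1 / real CARD('x)) *\<^sub>R G_pow 0" by (simp add: G_pow_0)
    then show ?thesis using 0 by (auto intro: span_scale span_base)
  next
    case (Suc m)
    then have m: "m < d" using less.prems by simp
    have lower: "E k \<in> span (G_pow ` {..l})" if "k \<le> m" for k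
    proof -
      have "span (G_pow ` {..k}) \<subseteq> span (G_pow ` {..l})"
        using that Suc by (intro span_mono) auto
      then show ?thesis using less.IH[of k] that Suc m by auto
    qed
    have "hadamard G (E m) = (\<Sum>k\<le>d. \<kappa> m k *\<^sub>R E k)"
      using m by (intro hadamard_G_E) simp
    also have "\<dots> = (\<Sum>k\<le>Suc m. \<kappa> m k *\<^sub>R E k)"
      using m \<kappa>_eq_0 by (intro sum.mono_neutral_right) auto
    also have "\<dots> = (\<Sum>k\<le>m. \<kappa> m k *\<^sub>R E k) + \<kappa> m l *\<^sub>R E l"
      using Suc by simp
    finally have "\<kappa> m l *\<^sub>R E l = hadamard G (E m) - (\<Sum>k\<le>m. \<kappa> m k *\<^sub>R E k)"
      by simp
    then have "E l = (1 / \<kappa> m l) *\<^sub>R (hadamard G (E m) - (\<Sum>k\<le>m. \<kappa> m k *\<^sub>R E k))"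
      using \<kappa>_Suc_neq_0[OF m] Suc by (metis divide_inverse mult_1 scaleR_one scaleR_scaleR left_inverse)
    moreover have "hadamard G (E m) \<in> span (G_pow ` {..l})"
      unfolding Suc using less.IH[of m] Suc m by (intro hadamard_G_span_G_pow) auto
    ultimately show ?thesis
      using lower by (simp only:) (intro span_scale span_diff span_sum, auto)
  qed
qed

text \<open>The identity matrix is an entrywise polynomial in \<open>G\<close>, so \<open>G\<close>
  cannot repeat its diagonal value off the diagonal.\<close>

lemma G_eq_1_imp_eq:
  assumes "G $ x $ y = 1"
  shows "x = y"
proof -
  have "M $ x $ y = M $ x $ x" if "M \<in> span (range G_pow)" for M
    using that by (induction rule: span_induct_alt) (auto simp: assms G_diag)
  moreover have "E l \<in> span (range G_pow)" if "l \<le> d" for l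
    using E_span_G_pow[OF that] span_mono[of "G_pow ` {..l}" "range G_pow"] by auto
  then have "mat 1 \<in> span (range G_pow)"
    unfolding sum_E[symmetric] by (intro span_sum) auto
  ultimately have "(mat 1 :: real^'x^'x) $ x $ y = mat 1 $ x $ x" by blast
  then show ?thesis by (auto simp: mat_def split: if_splits)
qed

text \<open>\<open>G\<close> is a multiple of an idempotent. Compared with the second moment on the
  sphere, this identifies the dimension with \<open>\<theta> 0\<close>.\<close>

lemma sum_G_square: "(\<Sum>z\<in>UNIV. (G $ x $ z)\<^sup>2) = real CARD('x) / \<theta> 0"
proof -
  have "(\<Sum>z\<in>UNIV. (G $ x $ z)\<^sup>2) = (G ** G) $ x $ x"
    unfolding matrix_matrix_mult_def power2_eq_square
    by (simp, intro sum.cong refl arg_cong2[of _ _ _ _ "(*)"] BM_symmetric G_BM)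
  also have "G ** G = (real CARD('x) / \<theta> 0) *\<^sub>R G"
    unfolding G_def using d_pos by (simp add: matrix_mult_scaleR_left matrix_mult_scaleR_right E_idem)
  finally show ?thesis by (simp add: G_diag)
qed

lemma ev_span_E:
  assumes "M \<in> span (E ` {..r})" "r < l" "l \<le> d"
  shows "ev M l = 0"
proof (rule ev_unique[OF assms(3)])
  show "M ** E l = 0 *\<^sub>R E l"
    using assms(1)
  proof (induction rule: span_induct_alt)
    case base
    then show ?case by (simp add: matrix_mult_zero_left)
  next
    case (step c B M)
    then obtain i where "i \<le> r" "B = E i" by auto
    then show ?case
      using step.IH E_orthogonal[of i l] assms(2,3)
      by (simp add: matrix_mult_add_left matrix_mult_scaleR_left)
  qed
qed

section \<open>Orthogonal polynomials in the Gram matrix\<close>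

lemma BM_G_pow: "G_pow r \<in> BM"
proof (induction r)
  case 0
  show ?case unfolding G_pow_0 using E_BM by (intro BM_scaleR) auto
next
  case (Suc r)
  then show ?case unfolding G_pow_Suc using BM_hadamard G_BM by blast
qed

text \<open>A diagonal entry of \<open>?W ** G_pow r\<close> is a row sum of a polynomial in
  \<open>G\<close>, which the moments and \<open>orth\<close> make 0. As \<open>E l\<close> is a
  combination of such powers with \<open>r \<le> l < i\<close>, the diagonal of
  \<open>?W ** E l\<close> vanishes, while that of \<open>E l\<close> is positive.\<close>

lemma ev_sum_G_pow_eq_0:
  assumes moments: "\<And>x r. r \<le> t \<Longrightarrow> (\<Sum>z\<in>UNIV. (G $ x $ z) ^ r) = real CARD('x) * \<mu> r"
    and orth: "\<And>r. r < i \<Longrightarrow> (\<Sum>k\<le>i. c k * \<mu> (k + r)) = 0"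
    and "2 * i \<le> t + 1" "l < i" "l \<le> d"
  shows "ev (\<Sum>k\<le>i. c k *\<^sub>R G_pow k) l = 0"
proof -
  let ?W = "\<Sum>k\<le>i. c k *\<^sub>R G_pow k"
  have W: "?W \<in> BM" by (intro BM_sum BM_scaleR BM_G_pow)
  fix x :: 'x
  have "(?W ** M) $ x $ x = 0" if "M \<in> span (G_pow ` {..l})" for M
    using that
  proof (induction rule: span_induct_alt)
    case base
    then show ?case by (simp add: matrix_mult_zero_right)
  next
    case (step b B M)
    then obtain r where r: "r \<le> l" "B = G_pow r" by auto
    have "(?W ** G_pow r) $ x $ x = (\<Sum>z\<in>UNIV. ?W $ x $ z * (G $ x $ z) ^ r)"
      unfolding matrix_matrix_mult_def G_pow_nth
      by (simp, intro sum.cong refl arg_cong2[of _ _ _ _ "(*)"] arg_cong2[of _ _ _ _ power]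
          BM_symmetric G_BM)
    also have "\<dots> = (\<Sum>z\<in>UNIV. \<Sum>k\<le>i. c k * (G $ x $ z) ^ (k + r))"
      by (simp add: sum_distrib_right power_add mult.assoc)
    also have "\<dots> = (\<Sum>k\<le>i. c k * (\<Sum>z\<in>UNIV. (G $ x $ z) ^ (k + r)))"
      by (subst sum.swap) (simp add: sum_distrib_left)
    \<comment> \<open>Here \<open>k \<le> i\<close> and \<open>r < i\<close> give
      \<open>k + r \<le> 2 * i - 1 \<le> t\<close>.\<close>
    also have "\<dots> = (\<Sum>k\<le>i. c k * (real CARD('x) * \<mu> (k + r)))"
      using assms(3,4) r(1) by (intro sum.cong refl, subst moments) auto
    also have "\<dots> = real CARD('x) * (\<Sum>k\<le>i. c k * \<mu> (k + r))"
      by (simp add: sum_distrib_left mult_ac)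
    also have "\<dots> = 0" using orth[of r] r(1) assms(4) by simp
    finally show ?case
      using step.IH r(2) by (simp add: matrix_add_ldistrib matrix_mult_scaleR_right)
  qed
  then have "(?W ** E l) $ x $ x = 0" using E_span_G_pow[OF assms(5)] by blast
  then show ?thesis
    using ev_eigen[OF W assms(5)] E_diag_pos[OF assms(5), of x] by simp
qed

text \<open>For \<open>i > d\<close> every eigenvalue of \<open>?W\<close> would vanish, although
  its diagonal entries are 1.\<close>

lemma design_degree_le:
  assumes moments: "\<And>x r. r \<le> t \<Longrightarrow> (\<Sum>z\<in>UNIV. (G $ x $ z) ^ r) = real CARD('x) * \<mu> r"
    and orth: "\<And>r. r < i \<Longrightarrow> (\<Sum>k\<le>i. c k * \<mu> (k + r)) = 0"
    and "2 * i \<le> t + 1" "(\<Sum>k\<le>i. c k) = 1"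
  shows "i \<le> d"
proof (rule ccontr)
  assume "\<not> i \<le> d"
  let ?W = "\<Sum>k\<le>i. c k *\<^sub>R G_pow k"
  have "?W \<in> BM" by (intro BM_sum BM_scaleR BM_G_pow)
  moreover have "ev ?W l = 0" if "l \<le> d" for l
    using that \<open>\<not> i \<le> d\<close> by (intro ev_sum_G_pow_eq_0[OF moments orth]) (use assms(3) in auto)
  ultimately have "?W = 0" using BM_decomp[of ?W] by simp
  moreover fix x
  have "?W $ x $ x = 1" using assms(4) by (simp add: G_diag)
  ultimately show False by simp
qed

text \<open>Orthogonality removes the components of \<open>?W\<close> below \<open>i\<close>, its
  degree in \<open>G\<close> those above; the unit diagonal fixes the remaining factor.\<close>

lemma E_nth_eq:
  assumes moments: "\<And>x r. r \<le> t \<Longrightarrow> (\<Sum>z\<in>UNIV. (G $ x $ z) ^ r) = real CARD('x) * \<mu> r"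
    and orth: "\<And>r. r < i \<Longrightarrow> (\<Sum>k\<le>i. c k * \<mu> (k + r)) = 0"
    and "2 * i \<le> t + 1" "(\<Sum>k\<le>i. c k) = 1"
  shows "E i $ x $ y = E i $ x $ x * (\<Sum>k\<le>i. c k * (G $ x $ y) ^ k)"
proof -
  have "i \<le> d" using assms by (rule design_degree_le)
  let ?W = "\<Sum>k\<le>i. c k *\<^sub>R G_pow k"
  have W: "?W \<in> BM" by (intro BM_sum BM_scaleR BM_G_pow)
  have "?W \<in> span (E ` {..i})"
  proof (intro span_sum span_scale)
    fix k assume "k \<in> {..i}"
    then show "G_pow k \<in> span (E ` {..i})"
      using G_pow_span_E[of k] span_mono[OF image_mono, of "{..k}" "{..i}" E] \<open>i \<le> d\<close> by auto
  qed
  then have "ev ?W l = 0" if "l \<le> d" "l \<noteq> i" for l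
    using that ev_span_E[of ?W i l] ev_sum_G_pow_eq_0[OF moments orth, of t l] assms(3)
    by (cases "l < i") auto
  then have "(\<Sum>l\<le>d. ev ?W l *\<^sub>R E l) = ev ?W i *\<^sub>R E i"
    using \<open>i \<le> d\<close> by (subst sum.remove[of _ i]) (auto intro!: sum.neutral)
  then have eq: "?W = ev ?W i *\<^sub>R E i" using BM_decomp[OF W] by simp
  have "?W $ x $ x = 1" using assms(4) by (simp add: G_diag)
  then have 1: "ev ?W i * E i $ x $ x = 1" using arg_cong[OF eq, of "\<lambda>M. M $ x $ x"] by simp
  have "(\<Sum>k\<le>i. c k * (G $ x $ y) ^ k) = ev ?W i * E i $ x $ y"
    using arg_cong[OF eq, of "\<lambda>M. M $ x $ y"] by simp
  then show ?thesis using 1 by (simp add: mult_ac)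
qed

end

section \<open>P- and Q-polynomial schemes\<close>

lemma graph_dist_relpow:
  assumes "\<Gamma>\<^sup>* = UNIV" shows "(x, y) \<in> \<Gamma> ^^ graph_dist \<Gamma> x y"
proof -
  have "(x, y) \<in> \<Gamma>\<^sup>*" using assms by simp
  then have "\<exists>n. (x, y) \<in> \<Gamma> ^^ n" by (rule rtrancl_imp_relpow)
  then show ?thesis unfolding graph_dist_def by (rule LeastI_ex)
qed

lemma graph_dist_le: "(x, y) \<in> \<Gamma> ^^ n \<Longrightarrow> graph_dist \<Gamma> x y \<le> n"
  unfolding graph_dist_def by (rule Least_le)

lemma graph_dist_triangle:
  assumes "\<Gamma>\<^sup>* = UNIV"
  shows "graph_dist \<Gamma> x y \<le> graph_dist \<Gamma> x z + graph_dist \<Gamma> z y"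
  using graph_dist_relpow[OF assms, of x z] graph_dist_relpow[OF assms, of z y]
  by (intro graph_dist_le) (auto simp: relpow_add)

primrec mat_pow :: "real^'x^'x \<Rightarrow> nat \<Rightarrow> real^'x^'x" where
  "mat_pow M 0 = mat 1"
| "mat_pow M (Suc n) = M ** mat_pow M n"

locale pq_polynomial_scheme = q_polynomial_scheme d R E q \<theta>
  for d :: nat and R :: "nat \<Rightarrow> ('x::finite \<times> 'x) set" and E :: "nat \<Rightarrow> real^'x^'x"
    and q :: "nat \<Rightarrow> nat \<Rightarrow> nat \<Rightarrow> real" and \<theta> :: "nat \<Rightarrow> real" +
  fixes \<sigma> :: "nat \<Rightarrow> nat"
  assumes bij: "bij_betw \<sigma> {..d} {..d}"
    and drg: "distance_regular_graph (R (\<sigma> 1))"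
    and dist_R: "\<forall>i\<le>d. R (\<sigma> i) = {(x, y). graph_dist (R (\<sigma> 1)) x y = i}"
begin

abbreviation "\<Gamma> \<equiv> R (\<sigma> 1)"
abbreviation "dist\<^sub>\<Gamma> \<equiv> graph_dist \<Gamma>"

definition A :: "real^'x^'x" where "A = adj_matrix \<Gamma>"

text \<open>For \<open>M \<in> BM\<close> and \<open>r \<le> d\<close> this amounts to
  \<open>M\<close> being a polynomial of degree at most \<open>r\<close> in
  \<open>A\<close>.\<close>

definition supported_le :: "nat \<Rightarrow> real^'x^'x \<Rightarrow> bool" where
  "supported_le r M \<longleftrightarrow> (\<forall>x y. r < dist\<^sub>\<Gamma> x y \<longrightarrow> M $ x $ y = 0)"

lemma connected: "\<Gamma>\<^sup>* = UNIV"
  using drg unfolding distance_regular_graph_def by blast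

lemma \<sigma>_le: "i \<le> d \<Longrightarrow> \<sigma> i \<le> d"
  using bij_betwE[OF bij] by blast

lemma dist_le: "dist\<^sub>\<Gamma> x y \<le> d"
  and rel_index_dist: "rel_index x y = \<sigma> (dist\<^sub>\<Gamma> x y)"
proof -
  have "rel_index x y \<in> \<sigma> ` {..d}"
    using rel_index[of x y] bij by (simp add: bij_betw_imp_surj_on)
  then obtain i where i: "i \<le> d" "rel_index x y = \<sigma> i" by auto
  then have "(x, y) \<in> R (\<sigma> i)" using rel_index[of x y] by simp
  then have "dist\<^sub>\<Gamma> x y = i" using dist_R i(1) by blast
  with i show "dist\<^sub>\<Gamma> x y \<le> d" "rel_index x y = \<sigma> (dist\<^sub>\<Gamma> x y)" by simp_all
qed

lemma BM_dist_cong: "M \<in> BM \<Longrightarrow> dist\<^sub>\<Gamma> x y = dist\<^sub>\<Gamma> x' y' \<Longrightarrow> M $ x $ y = M $ x' $ y'"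
  by (intro BM_entry_cong) (simp_all add: rel_index_dist)

lemma dist_attained:
  assumes "i \<le> d" obtains x y where "dist\<^sub>\<Gamma> x y = i"
proof -
  have "R (\<sigma> i) \<noteq> {}"
    using scheme \<sigma>_le[OF assms] unfolding symmetric_association_scheme_def by blast
  then obtain p where "p \<in> R (\<sigma> i)" by blast
  then have "dist\<^sub>\<Gamma> (fst p) (snd p) = i" using dist_R assms by auto
  then show ?thesis by (rule that)
qed

lemma dist_eq_0_iff: "dist\<^sub>\<Gamma> x y = 0 \<longleftrightarrow> x = y"
proof
  show "dist\<^sub>\<Gamma> x y = 0 \<Longrightarrow> x = y" using graph_dist_relpow[OF connected, of x y] by auto
  show "x = y \<Longrightarrow> dist\<^sub>\<Gamma> x y = 0" using graph_dist_le[of x y 0 \<Gamma>] by simp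
qed

lemma A_BM: "A \<in> BM"
  unfolding A_def using d_pos by (intro BM_adj \<sigma>_le) simp

lemma A_nth: "A $ x $ y = (if (x, y) \<in> \<Gamma> then 1 else 0)"
  by (simp add: A_def adj_matrix_def)

lemma supported_le_A: "supported_le 1 A"
  unfolding supported_le_def A_nth using graph_dist_le[of _ _ 1 \<Gamma>] by (metis leD relpow_1)

lemma supported_le_mult:
  assumes "supported_le r M" "supported_le s N"
  shows "supported_le (r + s) (M ** N)"
  unfolding supported_le_def
proof (intro allI impI)
  fix x y assume xy: "r + s < dist\<^sub>\<Gamma> x y"
  have "M $ x $ z * N $ z $ y = 0" for z
  proof -
    have "r < dist\<^sub>\<Gamma> x z \<or> s < dist\<^sub>\<Gamma> z y"
      using graph_dist_triangle[OF connected, of x y z] xy by linarith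
    then show ?thesis using assms by (auto simp: supported_le_def)
  qed
  then show "(M ** N) $ x $ y = 0" unfolding matrix_matrix_mult_def by (simp add: sum.neutral)
qed

section \<open>Powers of the adjacency matrix\<close>

lemma mat_pow_A_BM: "mat_pow A n \<in> BM"
  by (induction n) (simp_all add: BM_mat_1 BM_mult A_BM)

lemma supported_le_mat_pow_A: "supported_le n (mat_pow A n)"
proof (induction n)
  case 0
  show ?case using dist_eq_0_iff by (auto simp: supported_le_def mat_def)
next
  case (Suc n)
  then show ?case using supported_le_mult[OF supported_le_A Suc] by simp
qed

lemma mat_pow_A_nonneg: "mat_pow A n $ x $ y \<ge> 0"
proof (induction n arbitrary: x y)
  case (Suc n)
  then show ?case
    by (auto simp: matrix_matrix_mult_def A_nth intro!: sum_nonneg)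
qed (simp add: mat_def)

lemma mat_pow_A_pos: "(x, y) \<in> \<Gamma> ^^ n \<Longrightarrow> mat_pow A n $ x $ y > 0"
proof (induction n arbitrary: x)
  case (Suc n)
  obtain z where z: "(x, z) \<in> \<Gamma>" "(z, y) \<in> \<Gamma> ^^ n"
    using relpow_Suc_E2[OF Suc.prems] by blast
  have "0 < A $ x $ z * mat_pow A n $ z $ y"
    using z Suc.IH by (simp add: A_nth)
  also have "\<dots> \<le> (\<Sum>w\<in>UNIV. A $ x $ w * mat_pow A n $ w $ y)"
    by (rule member_le_sum) (auto simp: A_nth mat_pow_A_nonneg)
  finally show ?case by (simp add: matrix_matrix_mult_def)
qed (simp add: mat_def)

text \<open>Elements of the algebra are constant on each distance class, so a multiple of the
  highest power of \<open>A\<close> clears the outermost class, where that power is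
  positive.\<close>

lemma supported_le_imp_polynomial:
  assumes "M \<in> BM" "supported_le r M" "r \<le> d"
  shows "\<exists>c. M = (\<Sum>j\<le>r. c j *\<^sub>R mat_pow A j)"
  using assms
proof (induction r arbitrary: M)
  case 0
  fix w :: 'x
  define m where "m = M $ w $ w"
  have "M $ x $ y = (if x = y then m else 0)" for x y
  proof (cases "x = y")
    case True
    then show ?thesis using BM_diag_cong[OF 0(1), of x w] by (simp add: m_def)
  next
    case False
    then show ?thesis using 0(2) dist_eq_0_iff[of x y] unfolding supported_le_def by simp
  qed
  then have "M = m *\<^sub>R mat 1" by (simp add: vec_eq_iff mat_def)
  then show ?case by (intro exI[of _ "\<lambda>_. m"]) simp
next
  case (Suc r)
  obtain u v where uv: "dist\<^sub>\<Gamma> u v = Suc r" using dist_attained[OF Suc.prems(3)] .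
  let ?P = "mat_pow A (Suc r)"
  define a where "a = M $ u $ v / ?P $ u $ v"
  have "?P $ u $ v > 0"
    using graph_dist_relpow[OF connected, of u v] uv by (intro mat_pow_A_pos) simp
  then have a: "M $ u $ v = a * ?P $ u $ v" by (simp add: a_def)
  let ?N = "M - a *\<^sub>R ?P"
  have N: "?N \<in> BM" using Suc.prems(1) mat_pow_A_BM by (intro BM_diff BM_scaleR)
  have "supported_le r ?N"
    unfolding supported_le_def
  proof (intro allI impI)
    fix x y assume "r < dist\<^sub>\<Gamma> x y"
    then consider "dist\<^sub>\<Gamma> x y = Suc r" | "Suc r < dist\<^sub>\<Gamma> x y" by linarith
    then show "?N $ x $ y = 0"
    proof cases
      case 1
      then have "?N $ x $ y = ?N $ u $ v" using BM_dist_cong[OF N] uv by simp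
      then show ?thesis using a by (simp del: mat_pow.simps)
    next
      case 2
      then show ?thesis
        using Suc.prems(2) supported_le_mat_pow_A[of "Suc r"] unfolding supported_le_def
        by (simp del: mat_pow.simps)
    qed
  qed
  then obtain c where "?N = (\<Sum>j\<le>r. c j *\<^sub>R mat_pow A j)" using Suc.IH N Suc.prems(3) by auto
  then have "M = (\<Sum>j\<le>r. c j *\<^sub>R mat_pow A j) + a *\<^sub>R ?P" by (simp add: algebra_simps)
  also have "\<dots> = (\<Sum>j\<le>Suc r. (c(Suc r := a)) j *\<^sub>R mat_pow A j)"
    by (simp del: mat_pow.simps)
  finally show ?case by blast
qed

section \<open>Eigenvalues of the graph and Terwilliger's recurrence\<close>

abbreviation ev_A :: "nat \<Rightarrow> real" where "ev_A i \<equiv> ev A i"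

lemma ev_mat_pow_A: "i \<le> d \<Longrightarrow> ev (mat_pow A n) i = ev_A i ^ n"
  by (induction n) (simp_all add: ev_mat_1 ev_mult A_BM mat_pow_A_BM)

lemma ev_sum:
  assumes "i \<le> d" "\<And>s. s \<in> S \<Longrightarrow> f s \<in> BM"
  shows "ev (\<Sum>s\<in>S. f s) i = (\<Sum>s\<in>S. ev (f s) i)"
proof (rule ev_unique[OF assms(1)])
  show "(\<Sum>s\<in>S. f s) ** E i = (\<Sum>s\<in>S. ev (f s) i) *\<^sub>R E i"
    unfolding matrix_mult_sum_left scaleR_sum_left
    using assms by (intro sum.cong refl ev_eigen) auto
qed

lemma ev_polynomial:
  assumes "M \<in> BM" "supported_le r M" "r \<le> d"
  shows "\<exists>c. \<forall>i\<le>d. ev M i = (\<Sum>j\<le>r. c j * ev_A i ^ j)"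
proof -
  obtain c where M: "M = (\<Sum>j\<le>r. c j *\<^sub>R mat_pow A j)"
    using supported_le_imp_polynomial[OF assms] ..
  have "ev M i = (\<Sum>j\<le>r. c j * ev_A i ^ j)" if "i \<le> d" for i
    unfolding M using that
    by (simp add: ev_sum BM_scaleR mat_pow_A_BM ev_scaleR ev_mat_pow_A)
  then show ?thesis by blast
qed

text \<open>All distances are at most \<open>d\<close>, so \<open>E i\<close> is a polynomial in
  \<open>A\<close> and cannot separate indices with equal \<open>ev_A\<close>.\<close>

lemma ev_A_inj:
  assumes "i \<le> d" "j \<le> d" "ev_A i = ev_A j"
  shows "i = j"
proof -
  have "supported_le d (E i)" using dist_le unfolding supported_le_def by (meson leD)
  then obtain c where "\<forall>k\<le>d. ev (E i) k = (\<Sum>l\<le>d. c l * ev_A k ^ l)"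
    using ev_polynomial[OF E_BM[OF assms(1)]] by blast
  then have "ev (E i) i = ev (E i) j" using assms by simp
  then show ?thesis using assms by (auto simp: ev_E split: if_splits)
qed

text \<open>Terwilliger's relation: \<open>(A\<^sup>2 \<circ> G) A - (A \<circ> G) A\<^sup>2 = Z \<circ> G - Z\<close>, where the eigenvalues \<open>z\<^sub>i\<close> of \<open>Z\<close> are
  chosen to match both sides on neighbouring eigenspaces, which is all the tridiagonal \<open>\<kappa>\<close> can see.
  The left-hand side vanishes beyond distance 3, hence so does \<open>Z\<close>, and \<open>z\<^sub>i\<close> is a cubic in the
  eigenvalue \<open>ev_A i\<close>.\<close>

lemma ev_A_cubic:
  assumes "3 \<le> d"
  obtains c :: "nat \<Rightarrow> real"
  where "\<And>i. i < d \<Longrightarrow> ev_A i * ev_A (Suc i) * (ev_A (Suc i) - ev_A i)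
      = (\<Sum>j\<le>3. c j * ev_A (Suc i) ^ j) - (\<Sum>j\<le>3. c j * ev_A i ^ j)"
proof -
  \<comment> \<open>Partial sums, so that \<open>z (Suc i) - z i\<close> is the product in the
    claim.\<close>
  define z where "z i = (\<Sum>j<i. ev_A j * ev_A (Suc j) * (ev_A (Suc j) - ev_A j))" for i
  define Z where "Z = (\<Sum>i\<le>d. z i *\<^sub>R E i)"
  have Z_BM: "Z \<in> BM" unfolding Z_def using E_BM by (intro BM_sum BM_scaleR) auto
  have ev_Z: "ev Z i = z i" if "i \<le> d" for i
    unfolding Z_def using that by (rule ev_sum_scaleR_E)
  let ?B = "mat_pow A 2"
  have B_BM: "?B \<in> BM" by (rule mat_pow_A_BM)
  let ?L1 = "hadamard G ?B ** A" and ?L2 = "hadamard G A ** ?B"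
  have BM: "hadamard G ?B \<in> BM" "hadamard G A \<in> BM" "hadamard G Z \<in> BM"
    using BM_hadamard G_BM A_BM B_BM Z_BM by auto
  have L_BM: "?L1 \<in> BM" "?L2 \<in> BM"
    using BM_mult BM A_BM B_BM by auto
  \<comment> \<open>For \<open>i = k\<close> both brackets are 0, and for neighbours they agree by
    the increment of \<open>z\<close>. For all other pairs \<open>\<kappa> i k = 0\<close>.\<close>
  have step: "\<kappa> i k * (ev_A i ^ 2 * ev_A k - ev_A i * ev_A k ^ 2) = \<kappa> i k * (z i - z k)"
    if "i \<le> d" "k \<le> d" for i k
  proof (cases "i + 1 < k \<or> k + 1 < i")
    case True
    then show ?thesis using \<kappa>_eq_0 that by simp
  next
    case False
    then consider "i = k" | "k = Suc i" | "i = Suc k" by linarith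
    then have "ev_A i ^ 2 * ev_A k - ev_A i * ev_A k ^ 2 = z i - z k"
      by cases (simp_all add: z_def power2_eq_square algebra_simps)
    then show ?thesis by simp
  qed
  have "?L1 + Z = ?L2 + hadamard G Z"
  proof (rule BM_eqI)
    fix k assume k: "k \<le> d"
    have "ev ?L1 k - ev ?L2 k
        = (\<Sum>i\<le>d. ev_A i ^ 2 * \<kappa> i k) * ev_A k - (\<Sum>i\<le>d. ev_A i * \<kappa> i k) * ev_A k ^ 2"
      using k BM A_BM B_BM by (simp add: ev_mult ev_hadamard_G ev_mat_pow_A del: mat_pow.simps)
    also have "\<dots> = (\<Sum>i\<le>d. \<kappa> i k * (ev_A i ^ 2 * ev_A k - ev_A i * ev_A k ^ 2))"
      unfolding sum_distrib_right sum_subtractf[symmetric] by (simp add: algebra_simps)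
    also have "\<dots> = (\<Sum>i\<le>d. \<kappa> i k * (z i - z k))"
      using step k by (intro sum.cong) auto
    also have "\<dots> = (\<Sum>i\<le>d. z i * \<kappa> i k) - z k * (\<Sum>i\<le>d. \<kappa> i k)"
      unfolding sum_distrib_left sum_subtractf[symmetric] by (simp add: algebra_simps)
    \<comment> \<open>By \<open>sum_\<kappa>\<close> the factor of \<open>z k\<close> is 1.\<close>
    also have "\<dots> = ev (hadamard G Z) k - ev Z k"
      using k Z_BM by (simp add: sum_\<kappa> ev_Z ev_hadamard_G)
    finally show "ev (?L1 + Z) k = ev (?L2 + hadamard G Z) k"
      using ev_add[OF L_BM(1) Z_BM k] ev_add[OF L_BM(2) BM(3) k] by simp
  qed (intro BM_add L_BM Z_BM BM)+
  then have entry: "?L1 $ x $ y + Z $ x $ y = ?L2 $ x $ y + G $ x $ y * Z $ x $ y" for x y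
    by (metis hadamard_nth vector_add_component)
  have had: "supported_le r (hadamard G M)" if "supported_le r M" for r M
    using that by (simp add: supported_le_def)
  \<comment> \<open>Multiplying entrywise by \<open>G\<close> does not enlarge supports, and
    supports add under the matrix product.\<close>
  have L: "supported_le (2 + 1) ?L1" "supported_le (1 + 2) ?L2"
    by (intro supported_le_mult had supported_le_mat_pow_A supported_le_A)+
  have "supported_le 3 Z"
    unfolding supported_le_def
  proof (intro allI impI)
    fix x y assume xy: "3 < dist\<^sub>\<Gamma> x y"
    then have "Z $ x $ y = G $ x $ y * Z $ x $ y"
      using entry[of x y] L unfolding supported_le_def by (simp del: mat_pow.simps)
    \<comment> \<open>Off the diagonal \<open>G\<close> differs from 1, so the preceding equation
      forces the entry of \<open>Z\<close> to be 0.\<close>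
    moreover have "G $ x $ y \<noteq> 1"
      using G_eq_1_imp_eq[of x y] dist_eq_0_iff[of x y] xy by auto
    ultimately show "Z $ x $ y = 0" by simp
  qed
  then obtain c where c: "\<forall>i\<le>d. ev Z i = (\<Sum>j\<le>3. c j * ev_A i ^ j)"
    using ev_polynomial[OF Z_BM _ assms] by blast
  show thesis
  proof (rule that)
    fix i assume "i < d"
    then show "ev_A i * ev_A (Suc i) * (ev_A (Suc i) - ev_A i)
      = (\<Sum>j\<le>3. c j * ev_A (Suc i) ^ j) - (\<Sum>j\<le>3. c j * ev_A i ^ j)"
      using c[rule_format, of i] c[rule_format, of "Suc i"] ev_Z[of i] ev_Z[of "Suc i"]
      by (simp add: z_def)
  qed
qed

text \<open>Dividing the cubic relation by \<open>ev_A (Suc i) - ev_A i\<close> leaves a symmetric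
  quadratic one. Subtracting two consecutive instances leaves a multiple of
  \<open>ev_A (Suc (Suc i)) - ev_A i\<close>, which is nonzero as well.\<close>

lemma ev_A_three_term:
  assumes "3 \<le> d"
  obtains a b where "\<And>i. Suc (Suc i) \<le> d \<Longrightarrow>
    ev_A (Suc i) = a * (ev_A i + ev_A (Suc i) + ev_A (Suc (Suc i))) + b"
proof -
  obtain c where c: "\<And>i. i < d \<Longrightarrow> ev_A i * ev_A (Suc i) * (ev_A (Suc i) - ev_A i)
      = (\<Sum>j\<le>3. c j * ev_A (Suc i) ^ j) - (\<Sum>j\<le>3. c j * ev_A i ^ j)"
    using ev_A_cubic[OF assms] by blast
  have quad: "ev_A i * ev_A (Suc i) = c 3 * (ev_A i ^ 2 + ev_A i * ev_A (Suc i) + ev_A (Suc i) ^ 2)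
      + c 2 * (ev_A i + ev_A (Suc i)) + c 1" if "i < d" for i
  proof -
    have "ev_A (Suc i) - ev_A i \<noteq> 0" using ev_A_inj[of "Suc i" i] that by auto
    moreover have "(ev_A (Suc i) - ev_A i) * (ev_A i * ev_A (Suc i))
      = (ev_A (Suc i) - ev_A i) * (c 3 * (ev_A i ^ 2 + ev_A i * ev_A (Suc i) + ev_A (Suc i) ^ 2)
      + c 2 * (ev_A i + ev_A (Suc i)) + c 1)"
      using c[OF that] by (simp add: eval_nat_numeral algebra_simps)
    ultimately show ?thesis using mult_left_cancel by blast
  qed
  show thesis
  proof (rule that)
    fix i assume i: "Suc (Suc i) \<le> d"
    have "ev_A (Suc (Suc i)) - ev_A i \<noteq> 0" using ev_A_inj[of "Suc (Suc i)" i] i by auto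
    moreover have "(ev_A (Suc (Suc i)) - ev_A i) * ev_A (Suc i)
        = (ev_A (Suc (Suc i)) - ev_A i) * (c 3 * (ev_A i + ev_A (Suc i) + ev_A (Suc (Suc i))) + c 2)"
      using quad[of i] quad[of "Suc i"] i by (simp add: power2_eq_square algebra_simps)
    ultimately show "ev_A (Suc i) = c 3 * (ev_A i + ev_A (Suc i) + ev_A (Suc (Suc i))) + c 2"
      using mult_left_cancel by blast
  qed
qed

text \<open>Differences of three consecutive recurrences eliminate \<open>b\<close>; the two
  resulting equations share \<open>a\<close>, so cross-multiplying removes it without a
  division.\<close>

lemma ev_A_quadratic_relation:
  assumes "4 \<le> d"
  shows "(ev_A 1 - ev_A 2) * (ev_A 1 - ev_A 4) = (ev_A 0 - ev_A 3) * (ev_A 2 - ev_A 3)"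
proof -
  obtain a b where ab: "\<And>i. Suc (Suc i) \<le> d \<Longrightarrow>
    ev_A (Suc i) = a * (ev_A i + ev_A (Suc i) + ev_A (Suc (Suc i))) + b"
  proof (rule ev_A_three_term)
    show "3 \<le> d" using assms by simp
  qed blast
  have "ev_A 1 = a * (ev_A 0 + ev_A 1 + ev_A 2) + b"
    "ev_A 2 = a * (ev_A 1 + ev_A 2 + ev_A 3) + b"
    "ev_A 3 = a * (ev_A 2 + ev_A 3 + ev_A 4) + b"
    using ab[of 0] ab[of 1] ab[of 2] assms by (simp_all add: eval_nat_numeral)
  then have "ev_A 1 - ev_A 2 = a * (ev_A 0 - ev_A 3)" "ev_A 2 - ev_A 3 = a * (ev_A 1 - ev_A 4)"
    by (simp_all add: algebra_simps)
  then show ?thesis by simp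
qed

end

section \<open>Spherical designs\<close>

text \<open>Polarisation, applied inside the subspace.\<close>

lemma isometry_on_subspace_inner:
  fixes f :: "'a::real_inner \<Rightarrow> 'b::real_inner"
  assumes "linear f" "subspace S" "\<And>v. v \<in> S \<Longrightarrow> norm (f v) = norm v" "v \<in> S" "w \<in> S"
  shows "f v \<bullet> f w = v \<bullet> w"
  using assms(3)[OF subspace_add[OF assms(2,4,5)]] assms(3)[OF assms(4)] assms(3)[OF assms(5)]
  by (simp add: dot_norm linear_add[OF assms(1), symmetric])

context q_polynomial_scheme
begin

text \<open>The embedded points are scaled columns of \<open>E 1\<close>, and the Gram matrix of the
  columns of a symmetric idempotent is the idempotent itself.\<close>

lemma spherical_embedding_inner:
  assumes "column_space_identification (E 1) \<phi>"
  shows "spherical_embedding \<phi> (E 1) (\<theta> 0) x \<bullet> spherical_embedding \<phi> (E 1) (\<theta> 0) y = G $ x $ y"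
proof -
  let ?S = "span (columns (E 1))" and ?r = "sqrt (real CARD('x) / \<theta> 0)"
  have col: "?r *\<^sub>R column z (E 1) \<in> ?S" for z
    by (intro span_scale span_base) (auto simp: columns_def)
  have "spherical_embedding \<phi> (E 1) (\<theta> 0) x \<bullet> spherical_embedding \<phi> (E 1) (\<theta> 0) y
      = \<phi> (?r *\<^sub>R column x (E 1)) \<bullet> \<phi> (?r *\<^sub>R column y (E 1))"
    by (simp add: spherical_embedding_def matrix_vector_mult_basis)
  also have "\<dots> = (?r *\<^sub>R column x (E 1)) \<bullet> (?r *\<^sub>R column y (E 1))"
    using assms col unfolding column_space_identification_def
    by (intro isometry_on_subspace_inner[of _ ?S]) auto
  also have "\<dots> = (real CARD('x) / \<theta> 0) * (column x (E 1) \<bullet> column y (E 1))"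
    using \<theta>_0_pos by (simp add: real_sqrt_mult_self flip: mult.assoc)
  also have "column x (E 1) \<bullet> column y (E 1) = (\<Sum>z\<in>UNIV. E 1 $ x $ z * E 1 $ z $ y)"
    unfolding inner_vec_def column_def
    using BM_symmetric[OF E_BM[OF d_pos], of x] by simp
  also have "\<dots> = (E 1 ** E 1) $ x $ y"
    by (simp add: matrix_matrix_mult_def)
  also have "E 1 ** E 1 = E 1" using d_pos by (rule E_idem)
  finally show ?thesis by (simp add: G_def)
qed

text \<open>Test the design with the powers of \<open>u \<bullet> ?e x\<close>. The embedding is
  injective, so averaging over its range is averaging over the points, and invariance replaces
  \<open>?e x\<close> by the fixed \<open>v\<close>.\<close>

lemma sum_G_power_design:
  fixes \<phi> :: "real^'x \<Rightarrow> real^'n::finite"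
  assumes \<phi>: "column_space_identification (E 1) \<phi>"
    and design: "spherical_design t (range (spherical_embedding \<phi> (E 1) (\<theta> 0)))"
    and "r \<le> t" "norm (v :: real^'n) = 1"
  shows "(\<Sum>z\<in>UNIV. (G $ x $ z) ^ r) = real CARD('x) * (\<integral>u. (u \<bullet> v) ^ r \<partial>sphere_measure)"
proof -
  let ?e = "spherical_embedding \<phi> (E 1) (\<theta> 0)"
  note inner = spherical_embedding_inner[OF \<phi>]
  have norm: "norm (?e z) = 1" for z
    using inner[of z z] by (simp add: norm_eq_sqrt_inner G_diag)
  have inj: "inj ?e"
  proof (rule injI)
    fix y z assume "?e y = ?e z"
    then have "G $ y $ z = 1" using inner[of y z] inner[of z z] G_diag by simp
    then show "y = z" by (rule G_eq_1_imp_eq)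
  qed
  have "(\<Sum>u\<in>range ?e. (u \<bullet> ?e x) ^ r) / real (card (range ?e)) = (\<integral>u. (u \<bullet> ?e x) ^ r \<partial>sphere_measure)"
    using design polynomial_of_degree_le_inner_power[OF \<open>r \<le> t\<close>, of "?e x"]
    unfolding spherical_design_def by blast
  also have "(\<Sum>u\<in>range ?e. (u \<bullet> ?e x) ^ r) = (\<Sum>z\<in>UNIV. (G $ x $ z) ^ r)"
    unfolding sum.reindex[OF inj] comp_def
    by (intro sum.cong refl arg_cong2[of _ _ _ _ power]) (metis inner inner_commute)
  also have "card (range ?e) = CARD('x)" using inj by (rule card_image)
  also have "(\<integral>u. (u \<bullet> ?e x) ^ r \<partial>sphere_measure) = (\<integral>u. (u \<bullet> v) ^ r \<partial>sphere_measure)"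
    using norm assms(4) by (intro integral_sphere_inner_power_norm_cong) simp
  finally show ?thesis by (simp add: field_simps)
qed

end

text \<open>Coefficients of the Gegenbauer polynomials of dimension \<open>n\<close> and degree at most 4, normalised to
  take the value 1 at 1; they are the orthogonal polynomials for the moments of one coordinate on
  the unit sphere.\<close>

definition gegenbauer_coeff :: "real \<Rightarrow> nat \<Rightarrow> nat \<Rightarrow> real" where
  "gegenbauer_coeff n i k =
     [[1],
      [0, 1],
      [- 1 / (n - 1), 0, n / (n - 1)],
      [0, - 3 / (n - 1), 0, (n + 2) / (n - 1)],
      [3 / ((n - 1) * (n + 1)), 0, - 6 * (n + 2) / ((n - 1) * (n + 1)), 0,
        (n + 2) * (n + 4) / ((n - 1) * (n + 1))]] ! i ! k"

text \<open>Degree 4 against \<open>r = 3\<close> reaches the seventh moment, which is where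
  strength 7 enters.\<close>

lemma gegenbauer_coeff_orthogonal:
  fixes n :: real and \<mu> :: "nat \<Rightarrow> real"
  assumes "n > 2"
    and \<mu>: "\<mu> 0 = 1" "\<mu> 1 = 0" "\<mu> 2 = 1 / n" "\<mu> 3 = 0" "\<mu> 4 = 3 / (n * (n + 2))" "\<mu> 5 = 0"
      "\<mu> 6 = 15 / (n * (n + 2) * (n + 4))" "\<mu> 7 = 0"
    and "r < i" "i \<le> 4"
  shows "(\<Sum>k\<le>i. gegenbauer_coeff n i k * \<mu> (k + r)) = 0"
proof -
  have nz: "n \<noteq> 0" "n - 1 \<noteq> 0" "n + 1 \<noteq> 0" "n + 2 \<noteq> 0" "n + 4 \<noteq> 0"
    using assms(1) by auto
  \<comment> \<open>The moments with indices in successor form, the shape \<open>k + r\<close> takes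
    under \<open>eval_nat_numeral\<close>.\<close>
  note \<mu>' = \<mu>[unfolded eval_nat_numeral One_nat_def BitM.simps]
  have "i = 1 \<and> r = 0 \<or> i = 2 \<and> (r = 0 \<or> r = 1) \<or> i = 3 \<and> (r = 0 \<or> r = 1 \<or> r = 2)
    \<or> i = 4 \<and> (r = 0 \<or> r = 1 \<or> r = 2 \<or> r = 3)"
    using assms(10,11) by presburger
  then show ?thesis
    by (elim disjE conjE)
      (simp_all add: gegenbauer_coeff_def eval_nat_numeral \<mu>', simp_all add: divide_simps nz,
        simp_all add: algebra_simps)
qed

lemma gegenbauer_coeff_sum:
  assumes "n > 2" "i \<le> 4"
  shows "(\<Sum>k\<le>i. gegenbauer_coeff n i k) = 1"
proof -
  have nz: "n \<noteq> 1" "n + 1 \<noteq> 0"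
    using assms(1) by auto
  have "i = 0 \<or> i = 1 \<or> i = 2 \<or> i = 3 \<or> i = 4"
    using assms(2) by presburger
  then show ?thesis
    by (elim disjE)
      (simp_all add: gegenbauer_coeff_def eval_nat_numeral, simp_all add: divide_simps nz,
        simp_all add: algebra_simps)
qed

lemma gegenbauer_quadratic_relation:
  fixes n x :: real
  assumes "n > 2"
  defines "g \<equiv> \<lambda>i. \<Sum>k\<le>i. gegenbauer_coeff n i k * x ^ k"
  assumes "(g 1 - g 2) * (g 1 - g 4) = (g 0 - g 3) * (g 2 - g 3)"
  shows "x = 1 \<or> x = - 1"
proof -
  have nz: "n - 1 \<noteq> 0" "n + 1 \<noteq> 0"
    using assms(1) by auto
  \<comment> \<open>\<open>p2\<close>, \<open>p3\<close> and \<open>p4\<close> are the numerators of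
    \<open>g 2\<close>, \<open>g 3\<close> and \<open>g 4\<close>.\<close>
  define p2 where "p2 = n * x ^ 2 - 1"
  define p3 where "p3 = (n + 2) * x ^ 3 - 3 * x"
  define p4 where "p4 = (n + 2) * (n + 4) * x ^ 4 - 6 * (n + 2) * x ^ 2 + 3"
  have "g 0 = 1" "g 1 = x" "g 2 = p2 / (n - 1)" "g 3 = p3 / (n - 1)" "g 4 = p4 / ((n - 1) * (n + 1))"
    by (simp_all add: g_def gegenbauer_coeff_def eval_nat_numeral p2_def p3_def p4_def,
        simp_all add: divide_simps nz, simp_all add: algebra_simps)
  then have eq: "(x - p2 / (n - 1)) * (x - p4 / ((n - 1) * (n + 1)))
      = (1 - p3 / (n - 1)) * (p2 / (n - 1) - p3 / (n - 1))"
    using assms(3) by simp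
  have "((n - 1) * x - p2) * ((n - 1) * (n + 1) * x - p4)
      = (x - p2 / (n - 1)) * (x - p4 / ((n - 1) * (n + 1))) * ((n - 1)\<^sup>2 * (n + 1))"
    using nz by (simp add: divide_simps power2_eq_square, simp add: mult_ac)
  also have "\<dots> = (1 - p3 / (n - 1)) * (p2 / (n - 1) - p3 / (n - 1)) * ((n - 1)\<^sup>2 * (n + 1))"
    unfolding eq ..
  also have "\<dots> = (n + 1) * ((n - 1) - p3) * (p2 - p3)"
    using nz by (simp add: divide_simps power2_eq_square)
  finally have "((n - 1) * x - p2) * ((n - 1) * (n + 1) * x - p4) = (n + 1) * ((n - 1) - p3) * (p2 - p3)" .
  \<comment> \<open>The product is the difference of the two sides, factored.\<close>
  then have "(x - 1) ^ 4 * (x + 1) ^ 2 * ((n - 2) * (n + 2)) = 0"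
    unfolding p2_def p3_def p4_def by algebra
  then show ?thesis using assms(1) by auto
qed

section \<open>Graph eigenvalues as Gegenbauer values, and the contradiction\<close>

context pq_polynomial_scheme
begin

text \<open>Compare diagonal entries in \<open>A ** E i = ev_A i *\<^sub>R E i\<close>: all
  neighbours of \<open>x\<close> have the same entry of \<open>G\<close>, so the row sum
  factors.\<close>

lemma ev_A_eq:
  assumes "i \<le> d" "\<And>x y. E i $ x $ y = E i $ x $ x * p (G $ x $ y)" "(x, y) \<in> \<Gamma>"
  shows "ev_A i = (\<Sum>z\<in>UNIV. A $ x $ z) * p (G $ x $ y)"
proof -
  have \<Gamma>: "dist\<^sub>\<Gamma> u v = 1" if "(u, v) \<in> \<Gamma>" for u v
    using subsetD[OF equalityD1[OF dist_R[rule_format, OF d_pos]] that] by simp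
  have "ev_A i * E i $ x $ x = (A ** E i) $ x $ x"
    by (simp add: ev_eigen A_BM assms(1))
  also have "\<dots> = (\<Sum>z\<in>UNIV. A $ x $ z * E i $ z $ x)"
    by (simp add: matrix_matrix_mult_def)
  also have "\<dots> = (\<Sum>z\<in>UNIV. A $ x $ z * (p (G $ x $ y) * E i $ x $ x))"
  proof (intro sum.cong refl)
    fix z
    show "A $ x $ z * E i $ z $ x = A $ x $ z * (p (G $ x $ y) * E i $ x $ x)"
    proof (cases "(x, z) \<in> \<Gamma>")
      case True
      then have "G $ x $ z = G $ x $ y" using BM_dist_cong[OF G_BM] \<Gamma> assms(3) by simp
      then have "E i $ z $ x = p (G $ x $ y) * E i $ x $ x"
        using BM_symmetric[OF E_BM[OF assms(1)], of z x] assms(2)[of x z] by simp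
      then show ?thesis by simp
    qed (simp add: A_nth)
  qed
  also have "\<dots> = (\<Sum>z\<in>UNIV. A $ x $ z) * p (G $ x $ y) * E i $ x $ x"
    by (simp add: sum_distrib_right mult.assoc)
  finally show ?thesis using E_diag_pos[OF assms(1), of x] by simp
qed

theorem design_strength_le_6:
  fixes \<phi> :: "real^'x \<Rightarrow> real^'n::finite"
  assumes "\<theta> 0 > 2"
    and \<phi>: "column_space_identification (E 1) \<phi>"
    and design: "spherical_design t (range (spherical_embedding \<phi> (E 1) (\<theta> 0)))"
  shows "t \<le> 6"
proof (rule ccontr)
  assume "\<not> t \<le> 6"
  then have t: "r \<le> t" if "r \<le> 7" for r using that by simp
  obtain v :: "real^'n" where v: "norm v = 1" using norm_axis_1 by blast
  define \<mu> where "\<mu> r = (\<integral>u. (u \<bullet> v) ^ r \<partial>sphere_measure)" for r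
  have moments: "(\<Sum>z\<in>UNIV. (G $ x $ z) ^ r) = real CARD('x) * \<mu> r" if "r \<le> 7" for x r
    unfolding \<mu>_def by (rule sum_G_power_design[OF \<phi> design t[OF that] v])
  define n where "n = real CARD('n)"
  note even_moments = integral_sphere_inner_powers[OF v, folded n_def \<mu>_def]
  have "1 / n = 1 / \<theta> 0"
    using moments[of 2] sum_G_square even_moments(1) by (simp add: field_simps)
  then have n: "n > 2" using assms(1) by simp
  have \<mu>_0: "\<mu> 0 = 1" by (simp add: \<mu>_def measure_sphere_measure)
  have \<mu>_odd: "\<mu> r = 0" if "odd r" for r
    unfolding \<mu>_def using that by (rule integral_sphere_inner_odd_power)
  define c where "c = gegenbauer_coeff n"
  have orth: "(\<Sum>k\<le>i. c i k * \<mu> (k + r)) = 0" if "r < i" "i \<le> 4" for r i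
    unfolding c_def using n \<mu>_0 \<mu>_odd even_moments that
    by (intro gegenbauer_coeff_orthogonal) auto
  have total: "(\<Sum>k\<le>i. c i k) = 1" if "i \<le> 4" for i
    unfolding c_def using n that by (rule gegenbauer_coeff_sum)
  \<comment> \<open>Degree 4 is the largest that strength 7 supports:
    \<open>2 * 4 \<le> 7 + 1\<close>.\<close>
  have d: "4 \<le> d"
    by (rule design_degree_le[where t = 7 and \<mu> = \<mu> and c = "c 4"]) (use moments orth total in auto)
  obtain x y where "dist\<^sub>\<Gamma> x y = 1" using dist_attained[OF d_pos] .
  then have xy: "(x, y) \<in> \<Gamma>" using graph_dist_relpow[OF connected, of x y] by simp
  define K where "K = (\<Sum>z\<in>UNIV. A $ x $ z)"
  define \<xi> where "\<xi> = G $ x $ y"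
  define g where "g i = (\<Sum>k\<le>i. c i k * \<xi> ^ k)" for i
  have ev: "ev_A i = K * g i" if "i \<le> 4" for i
    unfolding K_def g_def \<xi>_def
  proof (rule ev_A_eq[where p = "\<lambda>s. \<Sum>k\<le>i. c i k * s ^ k", OF _ _ xy])
    show "i \<le> d" using that d by simp
    show "E i $ x $ y = E i $ x $ x * (\<Sum>k\<le>i. c i k * (G $ x $ y) ^ k)" for x y
      by (rule E_nth_eq[where t = 7 and \<mu> = \<mu>]) (use moments orth total that in auto)
  qed
  \<comment> \<open>Used twice: \<open>K = 0\<close> would make these eigenvalues all 0, and each
    value of \<open>\<xi>\<close> found below makes one pair equal.\<close>
  have ne: "ev_A 0 \<noteq> ev_A 1" "ev_A 0 \<noteq> ev_A 2"
    using ev_A_inj[of 0 1] ev_A_inj[of 0 2] d by auto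
  have "K\<^sup>2 * ((g 1 - g 2) * (g 1 - g 4)) = K\<^sup>2 * ((g 0 - g 3) * (g 2 - g 3))"
    using ev_A_quadratic_relation[OF d] by (simp add: ev power2_eq_square algebra_simps)
  moreover have "K \<noteq> 0" using ne by (auto simp: ev)
  ultimately have "(g 1 - g 2) * (g 1 - g 4) = (g 0 - g 3) * (g 2 - g 3)" by simp
  then have "\<xi> = 1 \<or> \<xi> = - 1"
    unfolding g_def c_def using n by (intro gegenbauer_quadratic_relation)
  \<comment> \<open>At 1 every \<open>g i\<close> is 1; at -1 the even polynomial \<open>g 2\<close>
    still is.\<close>
  then have "g 1 = g 0 \<or> g 2 = g 0"
    using total[of 2] by (auto simp: g_def c_def gegenbauer_coeff_def eval_nat_numeral)
  then show False using ne by (auto simp: ev)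
qed

end

text \<open>\<open>\<theta> 0 > 2\<close> excludes the circle, where regular polygons are designs of
  arbitrarily large strength.\<close>

theorem theorem4p3:
  fixes d t :: nat
    and R :: "nat \<Rightarrow> ('x::finite \<times> 'x) set"
    and E :: "nat \<Rightarrow> real^'x^'x"
    and q :: "nat \<Rightarrow> nat \<Rightarrow> nat \<Rightarrow> real"
    and \<theta> :: "nat \<Rightarrow> real"
    and \<phi> :: "real^'x \<Rightarrow> real^'n::finite"
  assumes "d \<ge> 1"
    and "symmetric_association_scheme d R"
    and "P_polynomial d R"
    and "primitive_idempotents d R E"
    and "krein_parameters d E q"
    and "Q_polynomial d q"
    and "E 1 = (1 / real CARD('x)) *\<^sub>R (\<Sum>j\<le>d. \<theta> j *\<^sub>R adj_matrix (R j))"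
    and "\<theta> 0 > 2"
    and "column_space_identification (E 1) \<phi>"
    and "spherical_design t (range (spherical_embedding \<phi> (E 1) (\<theta> 0)))"
  shows "t \<le> 8"
proof -
  obtain \<sigma> where \<sigma>: "bij_betw \<sigma> {..d} {..d}" "distance_regular_graph (R (\<sigma> 1))"
    "\<forall>i\<le>d. R (\<sigma> i) = {(x, y). graph_dist (R (\<sigma> 1)) x y = i}"
    using assms(3) unfolding P_polynomial_def by blast
  have "\<theta> 0 > 0" using assms(8) by simp
  interpret pq_polynomial_scheme d R E q \<theta> \<sigma>
    by unfold_locales fact+
  have "t \<le> 6" using assms(8-10) by (rule design_strength_le_6)
  then show ?thesis by simp
qed

end
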